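(* Let $m\in(0,1]$, let $f(q)=\sum_{k=0}^{\infty} q^kp_k\in \mathcal{SB}(\mathbb{B})$, and let $\omega_k\in\mathcal{SB}_k(\mathbb{B})$ for each $k\geq 1$. Then $$|p_0|^m+\sum_{k=1}^{\infty}|\omega_k(q)p_k|+\left(\frac{1}{1+|p_0|}+\frac{|\omega_1(q)|}{1-|\omega_1(q)|}\right)\sum_{k=1}^{\infty}|\omega_k(q)p_k|^2\leq 1\quad\text{for all } q \text{ with } |q|\leq \frac{m}{m+2}.$$ The constant $m/(m+2)$ is best possible for each $m\in(0,1]$, i.e. for fixed $m$ it cannot be replaced by any larger number so that the inequality remains true for all such $f$ and $(\omega_k)_{k\ge1}$.
   Context: $\mathbb{H}$ is the skew field of quaternions with its usual modulus $|\cdot|$; $\mathbb{B}=\{q\in\mathbb{H}:|q|<1\}$ with closure $\overline{\mathbb{B}}$. Let $\mathbb{S}=\{q\in\mathbb{H}:q^2=-1\}$ and, for $I\in\mathbb{S}$, $\mathbb{C}_I=\mathbb{R}\oplus I\mathbb{R}$ and $\mathbb{B}_I=\mathbb{B}\cap\mathbb{C}_I$. A function $f:\mathbb{B}\to\mathbb{H}$ is (left) slice regular if for every $I\in\mathbb{S}$ its restriction $f_I$ to $\mathbb{B}_I$ has continuous partial derivatives and satisfies $\frac12\left(\frac{\partial}{\partial x}+I\frac{\partial}{\partial y}\right)f_I(x+yI)=0$ for all $x+yI\in\mathbb{B}_I$. Every slice regular $f$ on $\mathbb{B}$ has a power series expansion $f(q)=\sum_{k=0}^\infty q^kp_k$ on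 $\mathbb{B}$ with $p_k\in\mathbb{H}$. The slice derivative $f'$ is defined on each $\mathbb{B}_I$ by $f'(x+yI)=\frac12\left(\frac{\partial}{\partial x}-I\frac{\partial}{\partial y}\right)f_I(x+yI)$; $f^{(j)}$ denotes the $j$-th iterated slice derivative, so $p_k=f^{(k)}(0)/k!$. $\mathcal{SB}(\mathbb{B})$ is the class of slice regular functions $f(q)=\sum_{k=0}^{\infty}q^kp_k$ on $\mathbb{B}$, continuous on $\overline{\mathbb{B}}$, such that $|f(q)|<1$ for all $|q|\leq 1$. For $n\geq1$, $\mathcal{SB}_n(\mathbb{B})$ is the set of $\omega\in\mathcal{SB}(\mathbb{B})$ with $\omega(0)=\omega'(0)=\dots=\omega^{(n-1)}(0)=0$ but $\omega^{(n)}(0)\neq0$. *)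

theory Defs
  imports "HOL-Analysis.Analysis"
begin

datatype quat = Quat (qre: real) (qim1: real) (qim2: real) (qim3: real)

lemma quat_eq_iff:
  "p = q \<longleftrightarrow> qre p = qre q \<and> qim1 p = qim1 q \<and> qim2 p = qim2 q \<and> qim3 p = qim3 q"
  by (cases p; cases q) auto

instantiation quat :: ab_group_add
begin

definition "0 = Quat 0 0 0 0"
definition "p + q = Quat (qre p + qre q) (qim1 p + qim1 q) (qim2 p + qim2 q) (qim3 p + qim3 q)"
definition "- p = Quat (- qre p) (- qim1 p) (- qim2 p) (- qim3 p)"
definition "p - q = Quat (qre p - qre q) (qim1 p - qim1 q) (qim2 p - qim2 q) (qim3 p - qim3 q)"

instance
  by standard
    (auto simp: zero_quat_def plus_quat_def uminus_quat_def minus_quat_def quat_eq_iff)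

end

lemma quat_zero_sel [simp]:
  "qre 0 = 0" "qim1 0 = 0" "qim2 0 = 0" "qim3 0 = 0"
  by (simp_all add: zero_quat_def)

lemma quat_add_sel [simp]:
  "qre (p + q) = qre p + qre q" "qim1 (p + q) = qim1 p + qim1 q"
  "qim2 (p + q) = qim2 p + qim2 q" "qim3 (p + q) = qim3 p + qim3 q"
  by (simp_all add: plus_quat_def)

lemma quat_uminus_sel [simp]:
  "qre (- p) = - qre p" "qim1 (- p) = - qim1 p" "qim2 (- p) = - qim2 p" "qim3 (- p) = - qim3 p"
  by (simp_all add: uminus_quat_def)

lemma quat_diff_sel [simp]:
  "qre (p - q) = qre p - qre q" "qim1 (p - q) = qim1 p - qim1 q"
  "qim2 (p - q) = qim2 p - qim2 q" "qim3 (p - q) = qim3 p - qim3 q"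
  by (simp_all add: minus_quat_def)

text \<open>
  The multiplication is Hamilton's: with \<open>i = Quat 0 1 0 0\<close>, \<open>j = Quat 0 0 1 0\<close> and
  \<open>k = Quat 0 0 0 1\<close> one has \<open>i\<^sup>2 = j\<^sup>2 = k\<^sup>2 = i * j * k = -1\<close>.
\<close>

instantiation quat :: ring_1
begin

definition "1 = Quat 1 0 0 0"
definition "p * q = Quat
  (qre p * qre q - qim1 p * qim1 q - qim2 p * qim2 q - qim3 p * qim3 q)
  (qre p * qim1 q + qim1 p * qre q + qim2 p * qim3 q - qim3 p * qim2 q)
  (qre p * qim2 q - qim1 p * qim3 q + qim2 p * qre q + qim3 p * qim1 q)
  (qre p * qim3 q + qim1 p * qim2 q - qim2 p * qim1 q + qim3 p * qre q)"

instance
  by standard (auto simp: one_quat_def times_quat_def quat_eq_iff algebra_simps)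

end

lemma quat_one_sel [simp]:
  "qre 1 = 1" "qim1 1 = 0" "qim2 1 = 0" "qim3 1 = 0"
  by (simp_all add: one_quat_def)

lemma quat_mult_sel [simp]:
  "qre (p * q) = qre p * qre q - qim1 p * qim1 q - qim2 p * qim2 q - qim3 p * qim3 q"
  "qim1 (p * q) = qre p * qim1 q + qim1 p * qre q + qim2 p * qim3 q - qim3 p * qim2 q"
  "qim2 (p * q) = qre p * qim2 q - qim1 p * qim3 q + qim2 p * qre q + qim3 p * qim1 q"
  "qim3 (p * q) = qre p * qim3 q + qim1 p * qim2 q - qim2 p * qim1 q + qim3 p * qre q"
  by (simp_all add: times_quat_def)

instantiation quat :: real_algebra_1
begin

definition "c *\<^sub>R q = Quat (c * qre q) (c * qim1 q) (c * qim2 q) (c * qim3 q)"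

instance
  by standard (auto simp: scaleR_quat_def quat_eq_iff algebra_simps)

end

lemma quat_scaleR_sel [simp]:
  "qre (c *\<^sub>R q) = c * qre q" "qim1 (c *\<^sub>R q) = c * qim1 q"
  "qim2 (c *\<^sub>R q) = c * qim2 q" "qim3 (c *\<^sub>R q) = c * qim3 q"
  by (simp_all add: scaleR_quat_def)

instantiation quat :: real_inner
begin

definition "inner p q = qre p * qre q + qim1 p * qim1 q + qim2 p * qim2 q + qim3 p * qim3 q"
definition "norm (q::quat) = sqrt (inner q q)"
definition "sgn (q::quat) = inverse (norm q) *\<^sub>R q"
definition "dist (p::quat) q = norm (p - q)"
definition "(uniformity :: (quat \<times> quat) filter) = (INF e\<in>{0 <..}. principal {(x, y). dist x y < e})"
definition "open (U :: quat set) \<longleftrightarrow>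
  (\<forall>x\<in>U. eventually (\<lambda>(x', y). x' = x \<longrightarrow> y \<in> U) uniformity)"

instance
proof
  fix p q r :: quat and c :: real
  show "inner p q = inner q p"
    by (simp add: inner_quat_def mult.commute)
  show "inner (p + q) r = inner p r + inner q r" "inner (c *\<^sub>R p) q = c * inner p q"
    by (simp_all add: inner_quat_def algebra_simps)
  show "0 \<le> inner p p"
    by (simp add: inner_quat_def)
  show "inner p p = 0 \<longleftrightarrow> p = 0"
    by (simp add: inner_quat_def quat_eq_iff add_nonneg_eq_0_iff)
qed (fact norm_quat_def sgn_quat_def dist_quat_def uniformity_quat_def open_quat_def)+

end

lemma norm_quat_eq: "norm q = sqrt ((qre q)\<^sup>2 + (qim1 q)\<^sup>2 + (qim2 q)\<^sup>2 + (qim3 q)\<^sup>2)"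
  by (simp add: norm_quat_def inner_quat_def power2_eq_square)

lemma norm_quat_sq: "(norm q)\<^sup>2 = (qre q)\<^sup>2 + (qim1 q)\<^sup>2 + (qim2 q)\<^sup>2 + (qim3 q)\<^sup>2"
  by (simp add: norm_quat_eq)

definition qcnj :: "quat \<Rightarrow> quat"
  where "qcnj q = Quat (qre q) (- qim1 q) (- qim2 q) (- qim3 q)"

lemma qcnj_sel [simp]:
  "qre (qcnj q) = qre q" "qim1 (qcnj q) = - qim1 q"
  "qim2 (qcnj q) = - qim2 q" "qim3 (qcnj q) = - qim3 q"
  by (simp_all add: qcnj_def)

lemma quat_mult_qcnj: "q * qcnj q = (norm q)\<^sup>2 *\<^sub>R 1"
  and qcnj_quat_mult: "qcnj q * q = (norm q)\<^sup>2 *\<^sub>R 1"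
  unfolding norm_quat_sq by (simp_all add: quat_eq_iff power2_eq_square algebra_simps)

instantiation quat :: real_normed_div_algebra
begin

definition "inverse (q::quat) = inverse ((norm q)\<^sup>2) *\<^sub>R qcnj q"
definition "p div (q::quat) = p * inverse q"

instance
proof
  fix p q :: quat
  show "inverse p * p = 1" "p * inverse p = 1" if "p \<noteq> 0"
    using that by (simp_all add: inverse_quat_def quat_mult_qcnj qcnj_quat_mult)
  show "p div q = p * inverse q"
    by (fact divide_quat_def)
  show "inverse (0::quat) = 0"
    by (simp add: inverse_quat_def)
  have "(norm (p * q))\<^sup>2 = (norm p * norm q)\<^sup>2"
    unfolding power_mult_distrib norm_quat_sq by simp algebra
  thus "norm (p * q) = norm p * norm q"
    by simp
qed

end

text \<open>
  Functions on the unit ball are represented by total functions on \<^typ>\<open>quat\<close>; only their values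
  on \<open>ball 0 1\<close> (or on \<open>cball 0 1\<close>, where continuity up to the boundary is asked for) matter.
  Since the ball is open, its slices contain a neighbourhood of each of their points, so the values
  elsewhere do not influence the partial derivatives below.
\<close>

definition imag_units :: "quat set"
  where "imag_units = {q. q\<^sup>2 = - 1}"

definition slice_point :: "quat \<Rightarrow> real \<Rightarrow> real \<Rightarrow> quat"
  where "slice_point I x y = of_real x + of_real y * I"

definition slice_dom :: "quat \<Rightarrow> (real \<times> real) set"
  where "slice_dom I = {(x, y). slice_point I x y \<in> ball 0 1}"

definition partial_x :: "(quat \<Rightarrow> quat) \<Rightarrow> quat \<Rightarrow> real \<Rightarrow> real \<Rightarrow> quat"
  where "partial_x f I x y = vector_derivative (\<lambda>t. f (slice_point I t y)) (at x)"

definition partial_y :: "(quat \<Rightarrow> quat) \<Rightarrow> quat \<Rightarrow> real \<Rightarrow> real \<Rightarrow> quat"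
  where "partial_y f I x y = vector_derivative (\<lambda>t. f (slice_point I x t)) (at y)"

definition slice_regular :: "(quat \<Rightarrow> quat) \<Rightarrow> bool"
  where "slice_regular f \<longleftrightarrow> (\<forall>I\<in>imag_units.
    (\<forall>(x, y)\<in>slice_dom I. (\<lambda>t. f (slice_point I t y)) differentiable (at x) \<and>
                          (\<lambda>t. f (slice_point I x t)) differentiable (at y)) \<and>
    continuous_on (slice_dom I) (\<lambda>(x, y). partial_x f I x y) \<and>
    continuous_on (slice_dom I) (\<lambda>(x, y). partial_y f I x y) \<and>
    (\<forall>(x, y)\<in>slice_dom I. (1/2) *\<^sub>R (partial_x f I x y + I * partial_y f I x y) = 0))"

text \<open>
  A non-real point is represented both as \<open>x + yI\<close> and as \<open>x + (-y)(-I)\<close>, and a real point lies on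
  every slice, so the slice derivative is defined as the common value over all representations.
  That there is such a value when \<open>f\<close> is slice regular is shown in \<open>slice_deriv_eq\<close> below.
\<close>

definition slice_deriv :: "(quat \<Rightarrow> quat) \<Rightarrow> quat \<Rightarrow> quat"
  where "slice_deriv f q = (THE d. \<forall>I\<in>imag_units. \<forall>x y. q = slice_point I x y \<longrightarrow>
    d = (1/2) *\<^sub>R (partial_x f I x y - I * partial_y f I x y))"

lemma imag_units_iff:
  "I \<in> imag_units \<longleftrightarrow> qre I = 0 \<and> (qim1 I)\<^sup>2 + (qim2 I)\<^sup>2 + (qim3 I)\<^sup>2 = 1"
proof
  assume "I \<in> imag_units"
  hence *: "(qre I)\<^sup>2 - (qim1 I)\<^sup>2 - (qim2 I)\<^sup>2 - (qim3 I)\<^sup>2 = -1"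
      "qre I * qim1 I = 0" "qre I * qim2 I = 0" "qre I * qim3 I = 0"
    by (auto simp: imag_units_def quat_eq_iff power2_eq_square)
  have "qre I = 0"
  proof (rule ccontr)
    assume "qre I \<noteq> 0"
    with * have "(qre I)\<^sup>2 = -1" by simp
    thus False using zero_le_power2[of "qre I"] by linarith
  qed
  with * show "qre I = 0 \<and> (qim1 I)\<^sup>2 + (qim2 I)\<^sup>2 + (qim3 I)\<^sup>2 = 1" by simp
next
  assume "qre I = 0 \<and> (qim1 I)\<^sup>2 + (qim2 I)\<^sup>2 + (qim3 I)\<^sup>2 = 1"
  thus "I \<in> imag_units"
    by (auto simp: imag_units_def quat_eq_iff power2_eq_square)
qed

lemma slice_point_sel [simp]:
  assumes "I \<in> imag_units"
  shows "qre (slice_point I x y) = x" "qim1 (slice_point I x y) = y * qim1 I"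
    "qim2 (slice_point I x y) = y * qim2 I" "qim3 (slice_point I x y) = y * qim3 I"
  using assms by (simp_all add: imag_units_iff slice_point_def of_real_def)

lemma slice_point_eq_cases:
  assumes "I \<in> imag_units" "J \<in> imag_units" and eq: "slice_point I x y = slice_point J u v"
  obtains "u = x" "y = 0" "v = 0" | "u = x" "v = y" "J = I" | "u = x" "v = - y" "J = - I"
proof -
  have u: "u = x" and c: "y * qim1 I = v * qim1 J" "y * qim2 I = v * qim2 J" "y * qim3 I = v * qim3 J"
    using arg_cong[OF eq, of qre] arg_cong[OF eq, of qim1] arg_cong[OF eq, of qim2]
      arg_cong[OF eq, of qim3] assms(1,2) by simp_all
  have I: "qre I = 0" "(qim1 I)\<^sup>2 + (qim2 I)\<^sup>2 + (qim3 I)\<^sup>2 = 1"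
    and J: "qre J = 0" "(qim1 J)\<^sup>2 + (qim2 J)\<^sup>2 + (qim3 J)\<^sup>2 = 1"
    using assms(1,2) by (auto simp: imag_units_iff)
  have "y\<^sup>2 * ((qim1 I)\<^sup>2 + (qim2 I)\<^sup>2 + (qim3 I)\<^sup>2) = v\<^sup>2 * ((qim1 J)\<^sup>2 + (qim2 J)\<^sup>2 + (qim3 J)\<^sup>2)"
    using c by (simp add: distrib_left flip: power_mult_distrib)
  hence "y\<^sup>2 = v\<^sup>2" using I J by simp
  then consider "v = y" | "v = - y" by (auto simp: power2_eq_iff)
  thus thesis
  proof cases
    case 1
    show thesis
    proof (cases "y = 0")
      case False
      hence "J = I" using c 1 I J by (simp add: quat_eq_iff)
      thus thesis using that u 1 by blast
    qed (use that u 1 in auto)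
  next
    case 2
    show thesis
    proof (cases "y = 0")
      case False
      hence "qim1 I = - qim1 J" "qim2 I = - qim2 J" "qim3 I = - qim3 J"
        using c 2 by (metis minus_mult_commute mult_left_cancel)+
      hence "J = - I" using I J by (simp add: quat_eq_iff)
      thus thesis using that u 2 by blast
    qed (use that u 2 in auto)
  qed
qed

lemma slice_deriv_eq:
  assumes f: "slice_regular f" and I: "I \<in> imag_units" and dom: "(x, y) \<in> slice_dom I"
  shows "slice_deriv f (slice_point I x y) =
    (1/2) *\<^sub>R (partial_x f I x y - I * partial_y f I x y)"
  unfolding slice_deriv_def
proof (rule the_equality)
  have real: "(1/2) *\<^sub>R (partial_x f K x 0 - K * partial_y f K x 0) =
      vector_derivative (\<lambda>t. f (of_real t)) (at x)"
    if K: "K \<in> imag_units" and "(x, 0) \<in> slice_dom K" for K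
  proof -
    have "partial_x f K x 0 + K * partial_y f K x 0 = 0"
      using f that unfolding slice_regular_def by fastforce
    hence "- (K * partial_y f K x 0) = partial_x f K x 0"
      by (simp add: add_eq_0_iff2)
    hence "(1/2) *\<^sub>R (partial_x f K x 0 - K * partial_y f K x 0) = partial_x f K x 0"
      using scaleR_half_double by (metis diff_conv_add_uminus mult_2 scaleR_right_distrib)
    thus ?thesis
      by (simp add: partial_x_def slice_point_def)
  qed
  show "\<forall>J\<in>imag_units. \<forall>u v. slice_point I x y = slice_point J u v \<longrightarrow>
      (1/2) *\<^sub>R (partial_x f I x y - I * partial_y f I x y) =
      (1/2) *\<^sub>R (partial_x f J u v - J * partial_y f J u v)"
  proof (intro ballI allI impI)
    fix J u v
    assume J: "J \<in> imag_units" and eq: "slice_point I x y = slice_point J u v"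
    have domJ: "(u, v) \<in> slice_dom J"
      using dom eq by (simp add: slice_dom_def)
    from I J eq show "(1/2) *\<^sub>R (partial_x f I x y - I * partial_y f I x y) =
        (1/2) *\<^sub>R (partial_x f J u v - J * partial_y f J u v)"
    proof (cases rule: slice_point_eq_cases)
      case 1
      thus ?thesis using real[OF I] real[OF J] dom domJ by simp
    next
      case 2
      thus ?thesis by simp
    next
      case 3
      have px: "partial_x f J u v = partial_x f I x y"
        using 3 by (simp add: partial_x_def slice_point_def)
      have "(\<lambda>t. f (slice_point I x t)) differentiable (at y)"
        using f I dom unfolding slice_regular_def by fast
      hence "((\<lambda>t. f (slice_point I x t)) has_vector_derivative partial_y f I x y) (at (- (- y)))"
        by (simp add: partial_y_def flip: vector_derivative_works)
      hence "((\<lambda>t. f (slice_point I x t)) \<circ> uminus has_vector_derivative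
          (- 1) *\<^sub>R partial_y f I x y) (at (- y))"
        by (intro vector_diff_chain_at) (auto intro!: derivative_eq_intros)
      moreover have "(\<lambda>t. f (slice_point I x t)) \<circ> uminus = (\<lambda>t. f (slice_point J u t))"
        using 3 by (auto simp: slice_point_def fun_eq_iff)
      ultimately have "partial_y f J u v = - partial_y f I x y"
        using 3 by (simp add: partial_y_def vector_derivative_at)
      thus ?thesis using px 3 by simp
    qed
  qed
qed (use I in blast)

definition SB :: "(quat \<Rightarrow> quat) set"
  where "SB = {f. slice_regular f \<and> continuous_on (cball 0 1) f \<and> (\<forall>q\<in>cball 0 1. norm (f q) < 1)}"

definition SB_n :: "nat \<Rightarrow> (quat \<Rightarrow> quat) set"
  where "SB_n n = {w\<in>SB. (\<forall>j<n. (slice_deriv ^^ j) w 0 = 0) \<and> (slice_deriv ^^ n) w 0 \<noteq> 0}"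

definition has_slice_expansion :: "(quat \<Rightarrow> quat) \<Rightarrow> (nat \<Rightarrow> quat) \<Rightarrow> bool"
  where "has_slice_expansion f p \<longleftrightarrow> (\<forall>q\<in>ball 0 1. (\<lambda>k. q ^ k * p k) sums f q)"

text \<open>
  Both series have nonnegative terms, so the inequality holds in \<open>[0, \<infinity>]\<close> only if they converge;
  as \<^const>\<open>suminf\<close> on \<^typ>\<open>real\<close> is unspecified for divergent series, convergence is demanded
  explicitly.
\<close>

definition bohr_ineq :: "real \<Rightarrow> (nat \<Rightarrow> quat) \<Rightarrow> (nat \<Rightarrow> quat \<Rightarrow> quat) \<Rightarrow> quat \<Rightarrow> bool"
  where "bohr_ineq m p w q \<longleftrightarrow>
    summable (\<lambda>k. norm (w (Suc k) q * p (Suc k))) \<and>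
    summable (\<lambda>k. (norm (w (Suc k) q * p (Suc k)))\<^sup>2) \<and>
    norm (p 0) powr m + (\<Sum>k. norm (w (Suc k) q * p (Suc k))) +
      (1 / (1 + norm (p 0)) + norm (w 1 q) / (1 - norm (w 1 q))) *
      (\<Sum>k. (norm (w (Suc k) q * p (Suc k)))\<^sup>2) \<le> 1"

end

theory Submission
  imports Defs "HOL-Complex_Analysis.Complex_Analysis"
begin

text \<open>
  Let \<open>f(q) = \<Sum> q\<^sup>k p\<^sub>k\<close> be bounded by 1. On a sphere \<open>x + y\<S>\<close> one has \<open>f(x + yI) = A + I B\<close>, and
  the supremum of \<open>|A + I B|\<close> over all imaginary units \<open>I\<close> is the norm of left multiplication by
  \<open>A + \<iota> B\<close> on the complexified quaternions \<open>\<H> \<otimes> \<C>\<close>. Averaging over roots of unity, the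
  lower triangular Toeplitz matrix of \<open>(p\<^sub>k)\<close> is therefore a contraction. Testing it on suitable
  vectors gives Carlson's inequalities
  \<open>|p\<^bsub>2n+1\<^esub>| \<le> 1 - |p\<^sub>0|\<^sup>2 - \<dots> - |p\<^sub>n|\<^sup>2\<close> and
  \<open>|p\<^bsub>2n\<^esub>| \<le> 1 - |p\<^sub>0|\<^sup>2 - \<dots> - |p\<^bsub>n-1\<^esub>|\<^sup>2 - |p\<^sub>n|\<^sup>2 / (1 + |p\<^sub>0|)\<close>,
  whose weighted sum bounds the two series by \<open>(1 - |p\<^sub>0|\<^sup>2) r / (1 - r)\<close> with \<open>r = |q|\<close>, once
  \<open>|\<omega>\<^sub>k(q)| \<le> r\<^sup>k\<close> is known from the Schwarz lemma on a slice. For \<open>r \<le> m / (m + 2)\<close> this is at most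
  \<open>(1 - |p\<^sub>0|\<^sup>2) m / 2 \<le> 1 - |p\<^sub>0|\<^sup>m\<close>.

  The radius is attained in the limit \<open>\<epsilon> \<rightarrow> 0\<close>, \<open>t \<rightarrow> 1\<close>, \<open>N \<rightarrow> \<infinity>\<close> by
  \<open>f = 1 - \<epsilon> (1 + 2 \<Sum>\<^bsub>1 \<le> k \<le> N\<^esub> t\<^sup>k q\<^sup>k)\<close>, a truncated Herglotz kernel with positive real part,
  together with \<open>\<omega>\<^sub>k(q) = t q\<^sup>k\<close>.
\<close>

section \<open>Toeplitz matrices of bounded slice regular functions\<close>

text \<open>For a unit I, the value |A + I B|^2 is affine in I, with linear part given by the
  imaginary part of \<open>B * qcnj A\<close>. The maximum is reached by opposing that vector, whose
  squared length is the Gram determinant of A and B.\<close>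

lemma imaginary_unit_maximizing_norm:
  fixes A B :: quat
  obtains I where "I \<in> imag_units"
    "(norm (A + I * B))\<^sup>2 = (norm A)\<^sup>2 + (norm B)\<^sup>2 + 2 * sqrt ((norm A)\<^sup>2 * (norm B)\<^sup>2 - (inner A B)\<^sup>2)"
proof -
  define W where "W = B * qcnj A"
  define x y z where "x = qim1 W" and "y = qim2 W" and "z = qim3 W"
  define t where "t = sqrt (x\<^sup>2 + y\<^sup>2 + z\<^sup>2)"
  have t2: "t\<^sup>2 = x\<^sup>2 + y\<^sup>2 + z\<^sup>2" by (simp add: t_def)
  have "(norm A)\<^sup>2 * (norm B)\<^sup>2 - (inner A B)\<^sup>2 = x\<^sup>2 + y\<^sup>2 + z\<^sup>2"
    unfolding norm_quat_sq inner_quat_def x_def y_def z_def W_def by simp algebra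
  hence t: "t = sqrt ((norm A)\<^sup>2 * (norm B)\<^sup>2 - (inner A B)\<^sup>2)" by (simp add: t_def)
  \<comment> \<open>If that vector vanishes, all units give the same norm, so an arbitrary one is
    taken.\<close>
  define I where "I = (if t = 0 then Quat 0 1 0 0 else Quat 0 (- x / t) (- y / t) (- z / t))"
  have I: "I \<in> imag_units"
    using t2 by (auto simp: imag_units_iff I_def power_divide simp flip: add_divide_distrib)
  have re: "qre I = 0" by (simp add: I_def)
  have xyz: "x = - t * qim1 I" "y = - t * qim2 I" "z = - t * qim3 I"
    using t2 by (auto simp: I_def add_nonneg_eq_0_iff)
  have "(norm (A + I * B))\<^sup>2 = (norm A)\<^sup>2 + ((qim1 I)\<^sup>2 + (qim2 I)\<^sup>2 + (qim3 I)\<^sup>2) * (norm B)\<^sup>2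
      - 2 * (qim1 I * x + qim2 I * y + qim3 I * z)"
    unfolding norm_quat_sq x_def y_def z_def W_def by (simp add: re) algebra
  also have "2 * (qim1 I * x + qim2 I * y + qim3 I * z) = - 2 * t * ((qim1 I)\<^sup>2 + (qim2 I)\<^sup>2 + (qim3 I)\<^sup>2)"
    unfolding xyz by algebra
  finally show thesis using that[OF I] I t by (simp add: imag_units_iff)
qed

text \<open>The left side is the squared norm of (A + \<iota> B)(U + \<iota> V), where \<iota> is a
  central imaginary unit. Its cross term is a dot product of imaginary vectors of lengths
  \<open>t\<close> and \<open>s\<close>: Cauchy-Schwarz bounds it by \<open>t * s\<close>,
  \<open>2 * s\<close> is at most |U|^2 + |V|^2, and the extremal unit I bounds \<open>t\<close>
  through C.\<close>

lemma complexified_quat_mult_contraction: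
  fixes A B U V :: quat
  assumes "\<And>I. I \<in> imag_units \<Longrightarrow> norm (A + I * B) \<le> C"
  shows "(norm (A * U - B * V))\<^sup>2 + (norm (A * V + B * U))\<^sup>2 \<le> C\<^sup>2 * ((norm U)\<^sup>2 + (norm V)\<^sup>2)"
proof -
  define t where "t = sqrt ((norm A)\<^sup>2 * (norm B)\<^sup>2 - (inner A B)\<^sup>2)"
  define s where "s = sqrt ((norm U)\<^sup>2 * (norm V)\<^sup>2 - (inner U V)\<^sup>2)"
  obtain I where I: "I \<in> imag_units" "(norm (A + I * B))\<^sup>2 = (norm A)\<^sup>2 + (norm B)\<^sup>2 + 2 * t"
    unfolding t_def by (rule imaginary_unit_maximizing_norm)
  have C: "(norm A)\<^sup>2 + (norm B)\<^sup>2 + 2 * t \<le> C\<^sup>2"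
    using assms[OF I(1)] I(2) by (metis norm_ge_zero power_mono)
  have cs: "0 \<le> (norm x)\<^sup>2 * (norm y)\<^sup>2 - (inner x y)\<^sup>2" for x y :: quat
    using Cauchy_Schwarz_ineq[of x y] by (simp add: power2_norm_eq_inner)
  have t0: "0 \<le> t" and s0: "0 \<le> s" using cs by (simp_all add: t_def s_def)
  define P Q where "P = qcnj A * B" and "Q = U * qcnj V"
  have im: "(qim1 P)\<^sup>2 + (qim2 P)\<^sup>2 + (qim3 P)\<^sup>2 = t\<^sup>2" "(qim1 Q)\<^sup>2 + (qim2 Q)\<^sup>2 + (qim3 Q)\<^sup>2 = s\<^sup>2"
    unfolding t_def s_def using cs[of A B] cs[of U V]
    by (simp_all add: P_def Q_def norm_quat_sq inner_quat_def) algebra+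
  have sUV: "2 * s \<le> (norm U)\<^sup>2 + (norm V)\<^sup>2"
  proof -
    have "s \<le> sqrt ((norm U)\<^sup>2 * (norm V)\<^sup>2)"
      unfolding s_def by (intro real_sqrt_le_mono) simp
    also have "\<dots> = norm U * norm V" by (simp add: real_sqrt_mult)
    finally show ?thesis using sum_squares_bound[of "norm U" "norm V"] by linarith
  qed
  have "\<bar>qim1 P * qim1 Q + qim2 P * qim2 Q + qim3 P * qim3 Q\<bar> \<le> t * s"
  proof -
    have "(qim1 P * qim1 Q + qim2 P * qim2 Q + qim3 P * qim3 Q)\<^sup>2 \<le>
      ((qim1 P)\<^sup>2 + (qim2 P)\<^sup>2 + (qim3 P)\<^sup>2) * ((qim1 Q)\<^sup>2 + (qim2 Q)\<^sup>2 + (qim3 Q)\<^sup>2)"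
      using Cauchy_Schwarz_ineq[of "Quat 0 (qim1 P) (qim2 P) (qim3 P)" "Quat 0 (qim1 Q) (qim2 Q) (qim3 Q)"]
      by (simp add: inner_quat_def power2_eq_square)
    thus ?thesis using t0 s0 unfolding im
      by (metis abs_le_square_iff abs_of_nonneg mult_nonneg_nonneg power_mult_distrib)
  qed
  moreover have "(norm (A * U - B * V))\<^sup>2 + (norm (A * V + B * U))\<^sup>2 =
     ((norm A)\<^sup>2 + (norm B)\<^sup>2) * ((norm U)\<^sup>2 + (norm V)\<^sup>2)
     - 4 * (qim1 P * qim1 Q + qim2 P * qim2 Q + qim3 P * qim3 Q)"
    unfolding P_def Q_def norm_quat_sq by simp algebra
  ultimately have "(norm (A * U - B * V))\<^sup>2 + (norm (A * V + B * U))\<^sup>2 \<le>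
     ((norm A)\<^sup>2 + (norm B)\<^sup>2) * ((norm U)\<^sup>2 + (norm V)\<^sup>2) + 2 * t * (2 * s)"
    by (simp add: abs_le_iff)
  also have "\<dots> \<le> ((norm A)\<^sup>2 + (norm B)\<^sup>2) * ((norm U)\<^sup>2 + (norm V)\<^sup>2) + 2 * t * ((norm U)\<^sup>2 + (norm V)\<^sup>2)"
    using sUV t0 by (intro add_left_mono mult_left_mono) auto
  also have "\<dots> = ((norm A)\<^sup>2 + (norm B)\<^sup>2 + 2 * t) * ((norm U)\<^sup>2 + (norm V)\<^sup>2)"
    by (simp add: algebra_simps)
  also have "\<dots> \<le> C\<^sup>2 * ((norm U)\<^sup>2 + (norm V)\<^sup>2)"
    using C by (intro mult_right_mono) auto
  finally show ?thesis .
qed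

section \<open>Slices as copies of the complex plane\<close>

text \<open>Having type \<open>complex\<close> as the source makes holomorphic function theory
  available on each slice. The map is multiplicative because I squares to -1.\<close>

definition slice_embed :: "quat \<Rightarrow> complex \<Rightarrow> quat"
  where "slice_embed I z = slice_point I (Re z) (Im z)"

lemma slice_embed_sel [simp]:
  assumes "I \<in> imag_units"
  shows "qre (slice_embed I z) = Re z" "qim1 (slice_embed I z) = Im z * qim1 I"
    "qim2 (slice_embed I z) = Im z * qim2 I" "qim3 (slice_embed I z) = Im z * qim3 I"
  using assms by (simp_all add: slice_embed_def)

lemma imag_unit_square: "I \<in> imag_units \<Longrightarrow> I * I = - 1"
  by (simp add: imag_units_def power2_eq_square)

lemma norm_imag_unit: "I \<in> imag_units \<Longrightarrow> norm I = 1"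
  by (simp add: norm_quat_eq imag_units_iff)

lemma slice_embed_eq: "slice_embed I z = Re z *\<^sub>R 1 + Im z *\<^sub>R I"
  by (simp add: slice_embed_def slice_point_def scaleR_conv_of_real)

lemma slice_embed_mult:
  assumes "I \<in> imag_units"
  shows "slice_embed I (z * w) = slice_embed I z * slice_embed I w"
  using imag_unit_square[OF assms]
  by (simp add: slice_embed_eq algebra_simps)

lemma slice_embed_0 [simp]: "slice_embed I 0 = 0"
  and slice_embed_1 [simp]: "slice_embed I 1 = 1"
  by (simp_all add: slice_embed_eq)

lemma slice_embed_add: "slice_embed I (z + w) = slice_embed I z + slice_embed I w"
  by (simp add: slice_embed_eq algebra_simps)

lemma slice_embed_scaleR: "slice_embed I (c *\<^sub>R z) = c *\<^sub>R slice_embed I z"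
  by (simp add: slice_embed_eq algebra_simps)

lemma slice_embed_power:
  assumes "I \<in> imag_units"
  shows "slice_embed I (z ^ n) = slice_embed I z ^ n"
  by (induction n) (simp_all add: slice_embed_mult[OF assms])

lemma norm_slice_embed:
  assumes "I \<in> imag_units"
  shows "norm (slice_embed I z) = norm z"
proof -
  have "(Im z)\<^sup>2 * ((qim1 I)\<^sup>2 + (qim2 I)\<^sup>2 + (qim3 I)\<^sup>2) = (Im z)\<^sup>2"
    using assms by (simp add: imag_units_iff)
  thus ?thesis
    using assms by (simp add: norm_quat_eq cmod_def power_mult_distrib distrib_left add.assoc)
qed

lemma bounded_linear_slice_embed:
  assumes "I \<in> imag_units"
  shows "bounded_linear (slice_embed I)"
  by (rule bounded_linear_intro[where K = 1])
    (simp_all add: slice_embed_add slice_embed_scaleR norm_slice_embed[OF assms])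

lemma quat_in_slice:
  obtains I z where "I \<in> imag_units" "q = slice_embed I z"
proof -
  define y where "y = sqrt ((qim1 q)\<^sup>2 + (qim2 q)\<^sup>2 + (qim3 q)\<^sup>2)"
  have y2: "y\<^sup>2 = (qim1 q)\<^sup>2 + (qim2 q)\<^sup>2 + (qim3 q)\<^sup>2" by (simp add: y_def)
  define I where "I = (if y = 0 then Quat 0 1 0 0 else Quat 0 (qim1 q / y) (qim2 q / y) (qim3 q / y))"
  have I: "I \<in> imag_units"
    using y2 by (auto simp: imag_units_iff I_def power_divide simp flip: add_divide_distrib)
  have "q = slice_embed I (Complex (qre q) y)"
    using I y2 by (auto simp: quat_eq_iff) (auto simp: I_def add_nonneg_eq_0_iff)
  thus thesis using that I by blast
qed

section \<open>Averaging over roots of unity\<close>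

text \<open>Since \<open>\<zeta> j ^ n = \<zeta> n ^ j\<close>, the sum is geometric with ratio
  \<open>\<zeta> n * cnj (\<zeta> l)\<close>. This ratio is an M-th root of unity and differs from 1
  for distinct n, l below M.\<close>

lemma sum_roots_of_unity_orthogonal:
  fixes \<zeta> :: "nat \<Rightarrow> complex"
  assumes "\<And>j. \<zeta> j = cis (2 * pi * real j / real M)" and "n < M" "l < M"
  shows "(\<Sum>j<M. \<zeta> j ^ n * cnj (\<zeta> j ^ l)) = (if n = l then of_nat M else 0)"
proof -
  have pw: "\<zeta> j ^ n = \<zeta> n ^ j" for j n
    unfolding assms(1) Complex.DeMoivre by (simp add: mult_ac)
  have [simp]: "\<zeta> j * cnj (\<zeta> j) = 1" for j
    by (simp add: assms(1) cis_cnj cis_mult)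
  have eq: "(\<Sum>j<M. \<zeta> j ^ n * cnj (\<zeta> j ^ l)) = (\<Sum>j<M. (\<zeta> n * cnj (\<zeta> l)) ^ j)"
    by (simp add: pw power_mult_distrib flip: complex_cnj_power)
  show ?thesis
  proof (cases "n = l")
    case False
    have "M > 0" using assms by simp
    have "\<zeta> n \<noteq> \<zeta> l"
      using bij_betw_imp_inj_on[OF Complex.bij_betw_roots_unity[OF \<open>M > 0\<close>]] assms False
      unfolding inj_on_def by auto
    hence ne: "\<zeta> n * cnj (\<zeta> l) \<noteq> 1"
      by (metis \<open>\<And>j. \<zeta> j * cnj (\<zeta> j) = 1\<close> mult.assoc mult.commute mult.right_neutral)
    have "\<zeta> j ^ M = 1" for j
      using \<open>M > 0\<close> cis_multiple_2pi[of "real j"] by (simp add: assms(1) Complex.DeMoivre mult_ac)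
    hence "(\<zeta> n * cnj (\<zeta> l)) ^ M = 1"
      by (simp add: power_mult_distrib flip: complex_cnj_power)
    thus ?thesis unfolding eq using False ne by (simp add: geometric_sum)
  next
    case True
    thus ?thesis unfolding eq by simp
  qed
qed

text \<open>Discrete Parseval identity in the complexification of a real inner product space, with
  real and imaginary components kept apart. Orthogonality leaves only the diagonal of the expanded
  squares.\<close>

lemma parseval_roots_of_unity:
  fixes w :: "nat \<Rightarrow> 'a::real_inner"
  assumes "\<And>j. \<zeta> j = cis (2 * pi * real j / real M)"
  shows "(\<Sum>j<M. (norm (\<Sum>n<M. Re (\<zeta> j ^ n) *\<^sub>R w n))\<^sup>2 + (norm (\<Sum>n<M. Im (\<zeta> j ^ n) *\<^sub>R w n))\<^sup>2)
    = real M * (\<Sum>n<M. (norm (w n))\<^sup>2)"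
proof -
  have sq: "(norm (\<Sum>n<M. c n *\<^sub>R w n))\<^sup>2 = (\<Sum>n<M. \<Sum>l<M. c n * c l * inner (w n) (w l))" for c
    unfolding power2_norm_eq_inner inner_sum_left inner_sum_right
    by (simp add: sum_distrib_left mult_ac inner_commute)
  have "(\<Sum>j<M. (norm (\<Sum>n<M. Re (\<zeta> j ^ n) *\<^sub>R w n))\<^sup>2 + (norm (\<Sum>n<M. Im (\<zeta> j ^ n) *\<^sub>R w n))\<^sup>2)
    = (\<Sum>j<M. \<Sum>n<M. \<Sum>l<M. Re (\<zeta> j ^ n * cnj (\<zeta> j ^ l)) * inner (w n) (w l))"
    unfolding sq by (simp add: algebra_simps flip: sum.distrib complex_cnj_power)
  also have "\<dots> = (\<Sum>n<M. \<Sum>l<M. \<Sum>j<M. Re (\<zeta> j ^ n * cnj (\<zeta> j ^ l)) * inner (w n) (w l))"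
    by (subst sum.swap) (intro sum.cong refl sum.swap)
  also have "\<dots> = (\<Sum>n<M. \<Sum>l<M. Re (\<Sum>j<M. \<zeta> j ^ n * cnj (\<zeta> j ^ l)) * inner (w n) (w l))"
    by (simp add: sum_distrib_right)
  also have "\<dots> = (\<Sum>n<M. \<Sum>l<M. if l = n then real M * (norm (w n))\<^sup>2 else 0)"
    by (intro sum.cong refl, subst sum_roots_of_unity_orthogonal[OF assms])
      (auto simp: power2_norm_eq_inner)
  finally show ?thesis by (simp add: sum_distrib_left)
qed

text \<open>At every M-th root of unity, multiplication by the symbol of p scales the norm of the
  generating polynomial of u by at most C. Parseval turns the sum of these pointwise bounds into the
  bound on coefficients.\<close>

lemma toeplitz_contraction_poly:
  fixes p u :: "nat \<Rightarrow> quat"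
  assumes C: "\<And>q. norm q = 1 \<Longrightarrow> norm (\<Sum>k<D. q ^ k * p k) \<le> C"
    and p: "\<And>k. k \<ge> D \<Longrightarrow> p k = 0" and u: "\<And>k. k > N \<Longrightarrow> u k = 0"
  shows "(\<Sum>n\<le>N. (norm (\<Sum>k\<le>n. p k * u (n - k)))\<^sup>2) \<le> C\<^sup>2 * (\<Sum>k\<le>N. (norm (u k))\<^sup>2)"
proof -
  \<comment> \<open>The product of the two polynomials has degree below this M, so there is no
    aliasing.\<close>
  define M where "M = D + N + 1"
  define \<zeta> where "\<zeta> j = cis (2 * pi * real j / real M)" for j
  define w where "w n = (\<Sum>k\<le>n. p k * u (n - k))" for n
  define A B U V where "A z = (\<Sum>k<D. Re (z ^ k) *\<^sub>R p k)" and "B z = (\<Sum>k<D. Im (z ^ k) *\<^sub>R p k)"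
    and "U z = (\<Sum>k<M. Re (z ^ k) *\<^sub>R u k)" and "V z = (\<Sum>k<M. Im (z ^ k) *\<^sub>R u k)" for z
  \<comment> \<open>Cauchy product: the triangle k + l < M and the rectangle contain the same
    nonzero terms, as p vanishes from D on and u beyond N.\<close>
  have conv: "(\<Sum>k<D. \<Sum>l<M. c (k + l) *\<^sub>R (p k * u l)) = (\<Sum>n<M. c n *\<^sub>R w n)" for c :: "nat \<Rightarrow> real"
  proof -
    have "(\<Sum>n<M. c n *\<^sub>R w n) = (\<Sum>n<M. \<Sum>k\<le>n. c (k + (n - k)) *\<^sub>R (p k * u (n - k)))"
      by (auto simp: w_def scaleR_sum_right intro!: sum.cong)
    also have "\<dots> = (\<Sum>(k,l)\<in>{(k,l). k + l < M}. c (k + l) *\<^sub>R (p k * u l))"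
      by (rule sum.triangle_reindex[symmetric])
    also have "\<dots> = (\<Sum>(k,l)\<in>{..<D} \<times> {..<M}. c (k + l) *\<^sub>R (p k * u l))"
    proof (rule sum.mono_neutral_cong)
      show "finite {(k, l). k + l < M}"
        by (rule finite_subset[of _ "{..<M} \<times> {..<M}"]) auto
      have "k < D" if "p k \<noteq> 0" for k using p[of k] that by (simp add: not_less[symmetric]) blast
      moreover have "l \<le> N" if "u l \<noteq> 0" for l using u[of l] that by (simp add: not_less[symmetric]) blast
      ultimately show "(case x of (k, l) \<Rightarrow> c (k + l) *\<^sub>R (p k * u l)) = 0"
        if "x \<in> {(k, l). k + l < M} - {..<D} \<times> {..<M}" for x
        using that by auto
      show "(case x of (k, l) \<Rightarrow> c (k + l) *\<^sub>R (p k * u l)) = 0"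
        if "x \<in> {..<D} \<times> {..<M} - {(k, l). k + l < M}" for x
        using that u by (auto simp: M_def)
    qed auto
    finally show ?thesis by (simp add: sum.cartesian_product)
  qed
  have pt: "(norm (\<Sum>n<M. Re (\<zeta> j ^ n) *\<^sub>R w n))\<^sup>2 + (norm (\<Sum>n<M. Im (\<zeta> j ^ n) *\<^sub>R w n))\<^sup>2
      \<le> C\<^sup>2 * ((norm (U (\<zeta> j)))\<^sup>2 + (norm (V (\<zeta> j)))\<^sup>2)" for j
  proof -
    let ?z = "\<zeta> j"
    have "A ?z * U ?z - B ?z * V ?z = (\<Sum>k<D. \<Sum>l<M. Re (?z ^ (k + l)) *\<^sub>R (p k * u l))"
      by (simp add: A_def B_def U_def V_def sum_product power_add scaleR_diff_left sum_subtractf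
          mult.commute[where 'a = real])
    moreover have "A ?z * V ?z + B ?z * U ?z = (\<Sum>k<D. \<Sum>l<M. Im (?z ^ (k + l)) *\<^sub>R (p k * u l))"
      by (simp add: A_def B_def U_def V_def sum_product power_add scaleR_add_left sum.distrib
          mult.commute[where 'a = real])
    \<comment> \<open>The value A + I B is the polynomial at a unit quaternion on the slice of I,
      where the hypothesis on C applies.\<close>
    moreover have "norm (A ?z + I * B ?z) \<le> C" if I: "I \<in> imag_units" for I
    proof -
      have "A ?z + I * B ?z = (\<Sum>k<D. slice_embed I ?z ^ k * p k)"
        by (simp add: A_def B_def sum_distrib_left flip: sum.distrib slice_embed_power[OF I])
          (simp add: slice_embed_eq algebra_simps)
      thus ?thesis using C[of "slice_embed I ?z"] by (simp add: norm_slice_embed[OF I] \<zeta>_def)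
    qed
    ultimately show ?thesis
      using complexified_quat_mult_contraction[of "A ?z" "B ?z" C "U ?z" "V ?z"] 
      by (simp add: conv[of "\<lambda>n. Re (?z ^ n)"] conv[of "\<lambda>n. Im (?z ^ n)"])
  qed
  have "(\<Sum>j<M. (norm (\<Sum>n<M. Re (\<zeta> j ^ n) *\<^sub>R w n))\<^sup>2 + (norm (\<Sum>n<M. Im (\<zeta> j ^ n) *\<^sub>R w n))\<^sup>2)
      \<le> (\<Sum>j<M. C\<^sup>2 * ((norm (U (\<zeta> j)))\<^sup>2 + (norm (V (\<zeta> j)))\<^sup>2))"
    by (intro sum_mono pt)
  hence "real M * (\<Sum>n<M. (norm (w n))\<^sup>2) \<le> C\<^sup>2 * (real M * (\<Sum>n<M. (norm (u n))\<^sup>2))"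
    unfolding U_def V_def sum_distrib_left[symmetric] parseval_roots_of_unity[OF \<zeta>_def] .
  hence "(\<Sum>n<M. (norm (w n))\<^sup>2) \<le> C\<^sup>2 * (\<Sum>n<M. (norm (u n))\<^sup>2)"
    by (simp add: M_def mult.left_commute)
  moreover have "(\<Sum>n\<le>N. (norm (w n))\<^sup>2) \<le> (\<Sum>n<M. (norm (w n))\<^sup>2)"
    by (intro sum_mono2) (auto simp: M_def)
  moreover have "(\<Sum>n<M. (norm (u n))\<^sup>2) = (\<Sum>n\<le>N. (norm (u n))\<^sup>2)"
    by (intro sum.mono_neutral_right) (auto simp: M_def not_le u)
  ultimately show ?thesis by (simp add: w_def)
qed

section \<open>From polynomials to bounded power series\<close>

lemma le_at_1_if_le_left:
  fixes g :: "real \<Rightarrow> real"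
  assumes "\<And>r. 0 < r \<Longrightarrow> r < 1 \<Longrightarrow> g r \<le> c" and "continuous_on UNIV g"
  shows "g 1 \<le> c"
proof (rule tendsto_upperbound)
  show "(g \<longlongrightarrow> g 1) (at_left 1)"
    using assms(2) by (metis continuous_on_def filterlim_at_split UNIV_I)
  show "\<forall>\<^sub>F r in at_left 1. g r \<le> c"
    using eventually_at_left_real[of 0 "1::real"] by (auto elim!: eventually_mono intro!: assms(1))
qed simp

lemma norm_sums_le_sums:
  fixes f :: "nat \<Rightarrow> 'a::real_normed_vector"
  assumes "f sums F" "g sums G" "\<And>n. norm (f n) \<le> g n"
  shows "norm F \<le> G"
proof (rule LIMSEQ_le)
  show "(\<lambda>n. norm (\<Sum>i<n. f i)) \<longlonglongrightarrow> norm F" "(\<lambda>n. \<Sum>i<n. g i) \<longlonglongrightarrow> G"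
    using assms by (auto simp: sums_def intro: tendsto_norm)
qed (use assms in \<open>auto intro: sum_norm_le\<close>)

text \<open>Convergence at one real point s between r and 1 suffices. Real numbers are central, so
  the coefficients can be moved to the left of the powers.\<close>

lemma slice_expansion_norm_summable:
  assumes "has_slice_expansion f p" and r: "0 \<le> r" "r < 1"
  shows "summable (\<lambda>k. r ^ k * norm (p k))"
proof -
  obtain s where s: "r < s" "s < 1" using dense r by blast
  have "summable (\<lambda>k. (of_real s :: quat) ^ k * p k)"
    using assms s by (auto simp: has_slice_expansion_def sums_iff)
  hence "summable (\<lambda>k. p k * (of_real s) ^ k)"
    by (simp add: Real_Vector_Spaces.of_real_def scaleR_power)
  from powser_insidea[OF this, of "of_real r"] show ?thesis
    using r s by (simp add: norm_mult norm_power mult.commute)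
qed

text \<open>Dilate f to radius r < 1 and cut the series at degree D. A tail below d raises the sup
  bound to 1 + d, so the polynomial case applies; then d tends to 0 and r to 1.\<close>

lemma toeplitz_contraction:
  assumes f: "has_slice_expansion f p" and b: "\<And>q. norm q < 1 \<Longrightarrow> norm (f q) \<le> 1"
    and u: "\<And>k. k > N \<Longrightarrow> u k = 0"
  shows "(\<Sum>n\<le>N. (norm (\<Sum>k\<le>n. p k * u (n - k)))\<^sup>2) \<le> (\<Sum>k\<le>N. (norm (u k))\<^sup>2)"
proof -
  define g where "g r = (\<Sum>n\<le>N. (norm (\<Sum>k\<le>n. (r ^ k *\<^sub>R p k) * u (n - k)))\<^sup>2)" for r
  have "g r \<le> (\<Sum>k\<le>N. (norm (u k))\<^sup>2)" if r: "0 < r" "r < 1" for r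
  proof (rule field_le_epsilon)
    fix e :: real assume e: "e > 0"
    define S where "S = (\<Sum>k\<le>N. (norm (u k))\<^sup>2)"
    have S: "S \<ge> 0" by (auto simp: S_def intro: sum_nonneg)
    have "((\<lambda>d. (1 + d)\<^sup>2 * S) \<longlongrightarrow> (1 + 0)\<^sup>2 * S) (at_right 0)"
      by (intro tendsto_intros)
    hence "\<forall>\<^sub>F d in at_right 0. (1 + d)\<^sup>2 * S < S + e"
      by (rule order_tendstoD) (use e in simp)
    moreover have "\<forall>\<^sub>F d in at_right (0::real). d > 0" by (rule eventually_at_right_less)
    ultimately have "\<forall>\<^sub>F d in at_right 0. 0 < d \<and> (1 + d)\<^sup>2 * S < S + e"
      by eventually_elim simp
    then obtain d where d: "0 < d" "(1 + d)\<^sup>2 * S < S + e"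
      using eventually_happens trivial_limit_at_right_real by blast
    have sm: "summable (\<lambda>k. r ^ k * norm (p k))"
      using slice_expansion_norm_summable[OF f] r by simp
    have "(\<lambda>n. \<Sum>k. r ^ (k + n) * norm (p (k + n))) \<longlonglongrightarrow> 0"
      using suminf_exist_split2[OF sm] by simp
    hence "\<forall>\<^sub>F n in sequentially. (\<Sum>k. r ^ (k + n) * norm (p (k + n))) < d"
      by (rule order_tendstoD) (use d in simp)
    with eventually_gt_at_top[of N] have "\<forall>\<^sub>F n in sequentially. n > N \<and> (\<Sum>k. r ^ (k + n) * norm (p (k + n))) < d"
      by eventually_elim simp
    \<comment> \<open>Taking D > N ensures that truncation leaves the rows 0 to N unchanged.\<close>
    then obtain D where D: "D > N" "(\<Sum>k. r ^ (k + D) * norm (p (k + D))) < d"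
      using eventually_happens trivial_limit_sequentially by blast
    define p' where "p' k = (if k < D then r ^ k *\<^sub>R p k else 0)" for k
    have "norm (\<Sum>k<D. q ^ k * p' k) \<le> 1 + d" if q: "norm q = 1" for q
    proof -
      have rq: "norm (r *\<^sub>R q) < 1" using q r by simp
      have s: "(\<lambda>k. (r *\<^sub>R q) ^ k * p k) sums f (r *\<^sub>R q)"
        using f rq unfolding has_slice_expansion_def by (metis mem_ball_0)
      have eq: "(\<Sum>k<D. q ^ k * p' k) = (\<Sum>k<D. (r *\<^sub>R q) ^ k * p k)"
        by (intro sum.cong) (auto simp: p'_def scaleR_power)
      have "(\<lambda>k. (r *\<^sub>R q) ^ (k + D) * p (k + D)) sums (f (r *\<^sub>R q) - (\<Sum>k<D. q ^ k * p' k))"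
        unfolding eq using sums_split_initial_segment[OF s] by simp
      hence "norm (f (r *\<^sub>R q) - (\<Sum>k<D. q ^ k * p' k)) \<le> (\<Sum>k. r ^ (k + D) * norm (p (k + D)))"
      proof (rule norm_sums_le_sums)
        show "(\<lambda>k. r ^ (k + D) * norm (p (k + D))) sums (\<Sum>k. r ^ (k + D) * norm (p (k + D)))"
          by (intro summable_sums summable_ignore_initial_segment[OF sm])
        show "norm ((r *\<^sub>R q) ^ (k + D) * p (k + D)) \<le> r ^ (k + D) * norm (p (k + D))" for k
          using q r by (simp add: norm_mult norm_power)
      qed
      moreover have "norm (f (r *\<^sub>R q)) \<le> 1" using b rq by blast
      ultimately show ?thesis using D norm_triangle_sub[of "\<Sum>k<D. q ^ k * p' k" "f (r *\<^sub>R q)"]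
        by (simp add: norm_minus_commute)
    qed
    from toeplitz_contraction_poly[OF this, of N u]
    have "(\<Sum>n\<le>N. (norm (\<Sum>k\<le>n. p' k * u (n - k)))\<^sup>2) \<le> (1 + d)\<^sup>2 * S"
      using u by (simp add: p'_def S_def)
    moreover have "(\<Sum>n\<le>N. (norm (\<Sum>k\<le>n. p' k * u (n - k)))\<^sup>2) = g r"
      unfolding g_def p'_def using D by (intro sum.cong refl arg_cong[of _ _ "\<lambda>x. (norm x)\<^sup>2"]) auto
    ultimately show "g r \<le> (\<Sum>k\<le>N. (norm (u k))\<^sup>2) + e"
      using d by (simp add: S_def)
  qed
  moreover have "continuous_on UNIV g"
    unfolding g_def by (intro continuous_intros)
  ultimately have "g 1 \<le> (\<Sum>k\<le>N. (norm (u k))\<^sup>2)"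
    by (rule le_at_1_if_le_left)
  thus ?thesis by (simp add: g_def)
qed

section \<open>Carlson's coefficient inequalities\<close>

lemma quat_polar:
  fixes q :: quat
  obtains y where "norm y = 1" "q = norm q *\<^sub>R y"
proof (cases "q = 0")
  case True
  show ?thesis by (rule that[of 1]) (auto simp: True)
next
  case False
  show ?thesis by (rule that[of "sgn q"]) (auto simp: False norm_sgn sgn_div_norm)
qed

lemma norm_qcnj [simp]: "norm (qcnj q) = norm q"
  by (simp add: norm_quat_eq)

text \<open>Compare squared norms: rows 0 to n return p_0, ..., p_n with total S, the last row has
  norm |p_(2n+1)| + S, and u has total 1 + S. The rows in between are dropped, so (|p_(2n+1)| + S)^2
  is at most 1.\<close>

lemma slice_coeff_bound_odd:
  assumes f: "has_slice_expansion f p" and b: "\<And>q. norm q < 1 \<Longrightarrow> norm (f q) \<le> 1"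
  shows "norm (p (2 * n + 1)) \<le> 1 - (\<Sum>k\<le>n. (norm (p k))\<^sup>2)"
proof -
  define S where "S = (\<Sum>k\<le>n. (norm (p k))\<^sup>2)"
  have S: "S \<ge> 0" by (auto simp: S_def intro: sum_nonneg)
  obtain y where y: "norm y = 1" "p (2 * n + 1) = norm (p (2 * n + 1)) *\<^sub>R y" by (rule quat_polar)
  \<comment> \<open>The tail of \<open>u\<close> makes the last entry \<open>T (2 * n + 1)\<close> a sum of quaternions with the same phase \<open>y\<close>.\<close>
  define u where "u k = (if k = 0 then 1 else if n < k \<and> k \<le> 2 * n + 1 then qcnj (p (2 * n + 1 - k)) * y else 0)" for k
  define T where "T i = (\<Sum>k\<le>i. p k * u (i - k))" for i
  have T_low: "T i = p i" if "i \<le> n" for i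
  proof -
    have "T i = (\<Sum>k\<in>{i}. p k * u (i - k))"
      unfolding T_def using that by (intro sum.mono_neutral_right) (auto simp: u_def)
    thus ?thesis by (simp add: u_def)
  qed
  have T_top: "T (2 * n + 1) = (norm (p (2 * n + 1)) + S) *\<^sub>R y"
  proof -
    have "T (2 * n + 1) = (\<Sum>k\<in>insert (2 * n + 1) {..n}. p k * u (2 * n + 1 - k))"
      unfolding T_def by (intro sum.mono_neutral_right) (auto simp: u_def)
    also have "\<dots> = p (2 * n + 1) + (\<Sum>k\<le>n. p k * (qcnj (p k) * y))"
      by (subst sum.insert) (auto simp: u_def intro!: sum.cong)
    also have "(\<Sum>k\<le>n. p k * (qcnj (p k) * y)) = S *\<^sub>R y"
      by (simp add: S_def quat_mult_qcnj scaleR_sum_left flip: mult.assoc)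
    finally show ?thesis using y by (simp add: scaleR_add_left)
  qed
  have "S + (norm (p (2 * n + 1)) + S)\<^sup>2 = (\<Sum>i\<in>insert (2 * n + 1) {..n}. (norm (T i))\<^sup>2)"
    using T_top y S by (subst sum.insert) (auto simp: T_low S_def)
  also have "\<dots> \<le> (\<Sum>i\<le>2 * n + 1. (norm (T i))\<^sup>2)"
    by (intro sum_mono2) auto
  also have "\<dots> \<le> (\<Sum>i\<le>2 * n + 1. (norm (u i))\<^sup>2)"
    unfolding T_def by (rule toeplitz_contraction[OF f b]) (auto simp: u_def)
  also have "\<dots> = (\<Sum>i\<in>insert 0 {n<..2*n+1}. (norm (u i))\<^sup>2)"
    by (intro sum.mono_neutral_right) (auto simp: u_def)
  also have "\<dots> = 1 + (\<Sum>i\<in>{n<..2*n+1}. (norm (p (2 * n + 1 - i)))\<^sup>2)"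
    by (subst sum.insert) (auto simp: u_def norm_mult y intro!: sum.cong)
  also have "(\<Sum>i\<in>{n<..2*n+1}. (norm (p (2 * n + 1 - i)))\<^sup>2) = S"
    unfolding S_def
    by (rule sum.reindex_bij_witness[of _ "\<lambda>i. 2 * n + 1 - i" "\<lambda>i. 2 * n + 1 - i"]) auto
  finally have "(norm (p (2 * n + 1)) + S)\<^sup>2 \<le> 1\<^sup>2" by simp
  hence "norm (p (2 * n + 1)) + S \<le> 1" by (rule power2_le_imp_le) simp
  thus ?thesis by (simp add: S_def)
qed

text \<open>The odd argument with one change: index n now lies in the middle and pairs with itself
  in row 2n, so its entry in u gets a weight of its own.\<close>

lemma slice_coeff_bound_even:
  assumes f: "has_slice_expansion f p" and b: "\<And>q. norm q < 1 \<Longrightarrow> norm (f q) \<le> 1" and n: "n > 0"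
  shows "norm (p (2 * n)) \<le> 1 - (\<Sum>k<n. (norm (p k))\<^sup>2) - (norm (p n))\<^sup>2 / (1 + norm (p 0))"
proof -
  define S where "S = (\<Sum>k<n. (norm (p k))\<^sup>2)"
  have S: "S \<ge> 0" by (auto simp: S_def intro: sum_nonneg)
  define \<beta> where "\<beta> = 1 / (1 + norm (p 0))"
  have "1 + norm (p 0) > 0" by (simp add: add_pos_nonneg)
  hence \<beta>: "\<beta> > 0" "1 - norm (p 0) * \<beta> = \<beta>" by (simp_all add: \<beta>_def field_simps)
  obtain y where y: "norm y = 1" "p (2 * n) = norm (p (2 * n)) *\<^sub>R y" by (rule quat_polar)
  \<comment> \<open>As in the odd case; with this \<open>\<beta>\<close> the entries of index \<open>n\<close> on both sides cancel.\<close>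
  define u where "u k = (if k = 0 then 1 else if k = n then \<beta> *\<^sub>R (qcnj (p n) * y)
      else if n < k \<and> k \<le> 2 * n then qcnj (p (2 * n - k)) * y else 0)" for k
  define T where "T i = (\<Sum>k\<le>i. p k * u (i - k))" for i
  have T_low: "T i = p i" if "i < n" for i
  proof -
    have "T i = (\<Sum>k\<in>{i}. p k * u (i - k))"
      unfolding T_def using that by (intro sum.mono_neutral_right) (auto simp: u_def)
    thus ?thesis by (simp add: u_def)
  qed
  \<comment> \<open>Row n combines p_n with p_0 times the middle entry of u. The reverse triangle
    inequality leaves |p_n| (1 - |p_0| \<beta>), which equals |p_n| \<beta>.\<close>
  have T_mid: "norm (T n) \<ge> norm (p n) * \<beta>"
  proof -
    have "T n = (\<Sum>k\<in>{0,n}. p k * u (n - k))"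
      unfolding T_def using n by (intro sum.mono_neutral_right) (auto simp: u_def)
    hence "T n = p n + \<beta> *\<^sub>R (p 0 * qcnj (p n) * y)"
      using n by (simp add: u_def add.commute mult.assoc)
    moreover have "norm (\<beta> *\<^sub>R (p 0 * qcnj (p n) * y)) = norm (p n) * (norm (p 0) * \<beta>)"
      using \<beta> y by (simp add: norm_mult mult_ac)
    ultimately have "norm (T n) \<ge> norm (p n) * (1 - norm (p 0) * \<beta>)"
      using norm_diff_ineq[of "p n" "\<beta> *\<^sub>R (p 0 * qcnj (p n) * y)"] by (simp add: algebra_simps)
    thus ?thesis by (simp add: \<beta>)
  qed
  have T_top: "T (2 * n) = (norm (p (2 * n)) + (norm (p n))\<^sup>2 * \<beta> + S) *\<^sub>R y"
  proof -
    have "T (2 * n) = (\<Sum>k\<in>insert (2 * n) (insert n {..<n}). p k * u (2 * n - k))"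
      unfolding T_def by (intro sum.mono_neutral_right) (auto simp: u_def)
    also have "\<dots> = p (2 * n) + (p n * (\<beta> *\<^sub>R (qcnj (p n) * y)) + (\<Sum>k<n. p k * (qcnj (p k) * y)))"
      using n by (subst sum.insert, simp, simp, subst sum.insert) (auto simp: u_def intro!: sum.cong)
    also have "(\<Sum>k<n. p k * (qcnj (p k) * y)) = S *\<^sub>R y"
      by (simp add: S_def quat_mult_qcnj scaleR_sum_left flip: mult.assoc)
    also have "p n * (\<beta> *\<^sub>R (qcnj (p n) * y)) = ((norm (p n))\<^sup>2 * \<beta>) *\<^sub>R y"
      by (simp add: quat_mult_qcnj flip: mult.assoc)
    finally show ?thesis using y by (simp add: scaleR_add_left add.assoc)
  qed
  have "S + (norm (p n) * \<beta>)\<^sup>2 + (norm (p (2 * n)) + (norm (p n))\<^sup>2 * \<beta> + S)\<^sup>2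
      \<le> (\<Sum>i\<in>insert (2 * n) (insert n {..<n}). (norm (T i))\<^sup>2)"
    using T_top y S \<beta> n power_mono[OF T_mid, of 2]
    by (subst sum.insert, simp, simp, subst sum.insert) (auto simp: T_low S_def)
  also have "\<dots> \<le> (\<Sum>i\<le>2 * n. (norm (T i))\<^sup>2)"
    by (intro sum_mono2) auto
  also have "\<dots> \<le> (\<Sum>i\<le>2 * n. (norm (u i))\<^sup>2)"
    unfolding T_def by (rule toeplitz_contraction[OF f b]) (auto simp: u_def)
  also have "\<dots> = (\<Sum>i\<in>insert 0 (insert n {n<..2*n}). (norm (u i))\<^sup>2)"
    by (intro sum.mono_neutral_right) (auto simp: u_def)
  also have "\<dots> = 1 + ((norm (p n) * \<beta>)\<^sup>2 + (\<Sum>i\<in>{n<..2*n}. (norm (p (2 * n - i)))\<^sup>2))"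
    using n \<beta> by (subst sum.insert, simp, simp, subst sum.insert)
      (auto simp: u_def norm_mult y mult.commute intro!: sum.cong)
  also have "(\<Sum>i\<in>{n<..2*n}. (norm (p (2 * n - i)))\<^sup>2) = S"
    unfolding S_def
    by (rule sum.reindex_bij_witness[of _ "\<lambda>i. 2 * n - i" "\<lambda>i. 2 * n - i"]) auto
  finally have "(norm (p (2 * n)) + (norm (p n))\<^sup>2 * \<beta> + S)\<^sup>2 \<le> 1\<^sup>2" by simp
  hence "norm (p (2 * n)) + (norm (p n))\<^sup>2 * \<beta> + S \<le> 1" by (rule power2_le_imp_le) simp
  thus ?thesis by (simp add: S_def \<beta>_def)
qed

section \<open>The Bohr-type inequality\<close>

text \<open>The linear terms are added in pairs, with indices 2N+1 and 2N+2, against one new square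
  of b_(N+1). The loss b_(N+1)^2 / (1 + b_0) in the even bound pays for the part 1 / (1 + b_0) of
  the factor, and the growth of \<open>S\<close> pays for r / (1 - r).\<close>

lemma bohr_majorant_partial_sums:
  fixes b :: "nat \<Rightarrow> real"
  assumes odd: "\<And>n. b (2 * n + 1) \<le> 1 - (\<Sum>k\<le>n. (b k)\<^sup>2)"
    and even: "\<And>n. n > 0 \<Longrightarrow> b (2 * n) \<le> 1 - (\<Sum>k<n. (b k)\<^sup>2) - (b n)\<^sup>2 / (1 + b 0)"
    and nonneg: "\<And>n. b n \<ge> 0" and r: "0 \<le> r" "r < 1"
  shows "(\<Sum>k<2*N. b (Suc k) * r ^ Suc k) + (1 / (1 + b 0) + r / (1 - r)) * (\<Sum>k<N. (b (Suc k) * r ^ Suc k)\<^sup>2)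
    \<le> (1 - (b 0)\<^sup>2) * (r / (1 - r))"
proof -
  define S where "S n = (\<Sum>k\<le>n. (b k)\<^sup>2)" for n
  define R where "R = r / (1 - r)"
  have R: "R \<ge> 0" "R * (1 - r) = r" using r by (simp_all add: R_def)
  have S_le: "S n \<le> 1" for n
    using odd[of n] nonneg[of "2 * n + 1"] by (simp add: S_def)
  \<comment> \<open>Strengthened so that the right side telescopes. The subtracted remainder is
    nonnegative because \<open>S N\<close> is at most 1, and is dropped at the end.\<close>
  have "(\<Sum>k<2*N. b (Suc k) * r ^ Suc k) + (1 / (1 + b 0) + R) * (\<Sum>k<N. (b (Suc k) * r ^ Suc k)\<^sup>2)
    \<le> R * ((1 - (b 0)\<^sup>2) - (1 - S N) * r ^ (2 * N))"
  proof (induction N)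
    case 0
    show ?case by (simp add: S_def)
  next
    case (Suc N)
    define c x where "c = 1 / (1 + b 0)" and "x = r ^ (2 * N)"
    have x: "x \<ge> 0" "r ^ N * r ^ N = x" using r by (simp_all add: x_def mult_2 power_add)
    have b1: "b (2 * N + 1) \<le> 1 - S N" using odd[of N] by (simp add: S_def)
    have b2: "b (2 * N + 2) \<le> 1 - S N - (b (Suc N))\<^sup>2 * c"
      using even[of "Suc N"] by (simp add: S_def c_def lessThan_Suc_atMost)
    have S1: "S (Suc N) = S N + (b (Suc N))\<^sup>2" by (simp add: S_def)
    have "b (2 * N + 1) * (r * x) + b (2 * N + 2) * (r\<^sup>2 * x)
        \<le> (1 - S N) * (r * x) + (1 - S N - (b (Suc N))\<^sup>2 * c) * (r\<^sup>2 * x)"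
      using b1 b2 x r by (intro add_mono mult_right_mono) auto
    \<comment> \<open>The terms with \<open>c\<close> cancel; what remains follows from r + r^2 = R
      (1 - r^2).\<close>
    moreover have "(1 - S N) * (r * x) + (1 - S N - (b (Suc N))\<^sup>2 * c) * (r\<^sup>2 * x)
        + (c + R) * ((b (Suc N))\<^sup>2 * (r\<^sup>2 * x)) = R * ((1 - S N) * x) - R * ((1 - S (Suc N)) * (r\<^sup>2 * x))"
    proof -
      have "r + r\<^sup>2 = R * (1 - r) * (1 + r)" unfolding R(2) by (simp add: algebra_simps power2_eq_square)
      hence "(1 - S N) * x * (r + r\<^sup>2) = (1 - S N) * x * (R * (1 - r) * (1 + r))" by simp
      thus ?thesis unfolding S1 by (simp add: algebra_simps power2_eq_square)
    qed
    moreover have "(\<Sum>k<2 * Suc N. b (Suc k) * r ^ Suc k) =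
        (\<Sum>k<2*N. b (Suc k) * r ^ Suc k) + (b (2 * N + 1) * (r * x) + b (2 * N + 2) * (r\<^sup>2 * x))"
      by (simp add: x_def power2_eq_square)
    moreover have "(c + R) * (\<Sum>k<Suc N. (b (Suc k) * r ^ Suc k)\<^sup>2) =
        (c + R) * (\<Sum>k<N. (b (Suc k) * r ^ Suc k)\<^sup>2) + (c + R) * ((b (Suc N))\<^sup>2 * (r\<^sup>2 * x))"
      unfolding x(2)[symmetric] by (simp add: power_mult_distrib power2_eq_square algebra_simps)
    moreover have "r ^ (2 * Suc N) = r\<^sup>2 * x" by (simp add: x_def power2_eq_square)
    ultimately show ?case
      using Suc.IH unfolding c_def[symmetric] x_def[symmetric] by (simp add: algebra_simps)
  qed
  also have "\<dots> \<le> R * (1 - (b 0)\<^sup>2)"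
    using R S_le[of N] r by (intro mult_left_mono) auto
  finally show ?thesis by (simp add: R_def mult.commute)
qed

text \<open>Weighted AM-GM for a^2 and 1 with weights m/2 and 1 - m/2, obtained from concavity of
  \<open>ln\<close>; the geometric mean is a^m.\<close>

lemma powr_plus_half_le_1:
  fixes a m :: real
  assumes m: "0 < m" "m \<le> 1" and a: "0 \<le> a" "a \<le> 1"
  shows "a powr m + (1 - a\<^sup>2) * (m / 2) \<le> 1"
proof (cases "a = 0")
  case False
  with a have a0: "a > 0" by simp
  define c where "c = 1 - (1 - a\<^sup>2) * (m / 2)"
  have "a powr m = exp (m / 2 * ln (a\<^sup>2))"
    using a0 by (simp add: powr_def ln_realpow)
  have "ln (1 + (a\<^sup>2 - 1)) * (m / 2) + ln 1 * (1 - m / 2) \<le> ln (c)"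
    using concave_onD[OF ln_concave, of "m/2" 1 "a\<^sup>2"] m a0
    by (simp add: c_def algebra_simps)
  hence "ln (a powr m) \<le> ln c" using a0 by (simp add: ln_powr ln_realpow mult.commute)
  moreover have "c > 0"
  proof -
    have "(1 - a\<^sup>2) * (m / 2) < 1 * 1" by (rule mult_less_le_imp_less) (use a0 m a in \<open>auto simp: power_le_one\<close>)
    thus ?thesis by (simp add: c_def)
  qed
  ultimately have "a powr m \<le> c" using a0 by (metis ln_le_cancel_iff powr_gt_zero less_irrefl)
  thus ?thesis by (simp add: c_def)
qed (use m in auto)

text \<open>The bounds on w dominate \<open>x\<close> by \<open>y\<close> termwise, and s / (1 - s)
  increases with s. So the majorant inequality controls all partial sums, and the series follow in
  the limit.\<close>

lemma bohr_ineq_from_schwarz_bounds: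
  assumes m: "0 < m" "m \<le> 1" and q: "norm q \<le> m / (m + 2)"
    and f: "has_slice_expansion f p" and b: "\<And>q. norm q < 1 \<Longrightarrow> norm (f q) \<le> 1"
    and w: "\<And>k. k \<ge> 1 \<Longrightarrow> norm (w k q) \<le> norm q ^ k"
  shows "bohr_ineq m p w q"
proof -
  define r a where "r = norm q" and "a = norm (p 0)"
  have m1: "m / (m + 2) < 1" using m by simp
  have r: "0 \<le> r" "r < 1" using q m1 by (auto simp: r_def)
  have a: "0 \<le> a" "a \<le> 1"
  proof -
    have "(\<lambda>k. 0 ^ k * p k) sums f 0" using f by (simp add: has_slice_expansion_def)
    moreover have "(\<lambda>k. 0 ^ k * p k) sums p 0" 
      using sums_finite[of "{0}" "\<lambda>k. 0 ^ k * p k"] by simp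
    ultimately have "p 0 = f 0" using sums_unique2 by blast
    thus "a \<le> 1" using b[of 0] by (simp add: a_def)
  qed (simp add: a_def)
  \<comment> \<open>Here the radius enters: for r < 1, r \<le> m / (m + 2) is equivalent to this
    bound.\<close>
  have R: "r / (1 - r) \<le> m / 2"
    using q r m by (simp add: r_def field_simps)
  define x where "x k = norm (w (Suc k) q * p (Suc k))" for k
  define y where "y k = norm (p (Suc k)) * r ^ Suc k" for k
  have xy: "0 \<le> x k" "x k \<le> y k" for k
    using mult_right_mono[OF w[of "Suc k"] norm_ge_zero[of "p (Suc k)"]]
    by (simp_all add: x_def y_def norm_mult r_def mult.commute)
  have sy: "summable y"
    using slice_expansion_norm_summable[OF f r] unfolding y_def
    by (subst (asm) summable_Suc_iff[symmetric]) (simp add: mult.commute)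
  have sx: "summable x" by (rule summable_comparison_test'[OF sy, of 0]) (use xy in auto)
  have sx2: "summable (\<lambda>k. (x k)\<^sup>2)"
  proof (rule summable_comparison_test_ev)
    have "x \<longlonglongrightarrow> 0" by (rule summable_LIMSEQ_zero[OF sx])
    hence "\<forall>\<^sub>F k in sequentially. x k < 1" by (rule order_tendstoD) simp
    thus "\<forall>\<^sub>F k in sequentially. norm ((x k)\<^sup>2) \<le> x k"
      by eventually_elim (use xy in \<open>simp add: power2_eq_square mult_left_le\<close>)
  qed (rule sx)
  define \<omega> where "\<omega> = norm (w 1 q)"
  have om: "0 \<le> \<omega>" "\<omega> \<le> r" using w[of 1] by (simp_all add: \<omega>_def r_def)
  have C: "1 / (1 + a) + \<omega> / (1 - \<omega>) \<le> 1 / (1 + a) + r / (1 - r)"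
    using om r by (intro add_left_mono frac_le) auto
  have C0: "0 \<le> 1 / (1 + a) + \<omega> / (1 - \<omega>)" using om r a by simp
  have fin: "(\<Sum>k<2*N. x k) + (1 / (1 + a) + \<omega> / (1 - \<omega>)) * (\<Sum>k<N. (x k)\<^sup>2) \<le> (1 - a\<^sup>2) * (m / 2)" for N
  proof -
    have "(\<Sum>k<2*N. x k) + (1 / (1 + a) + \<omega> / (1 - \<omega>)) * (\<Sum>k<N. (x k)\<^sup>2)
        \<le> (\<Sum>k<2*N. y k) + (1 / (1 + a) + r / (1 - r)) * (\<Sum>k<N. (y k)\<^sup>2)"
      using C C0 xy by (intro add_mono mult_mono sum_mono power_mono sum_nonneg) auto
    also have "\<dots> \<le> (1 - a\<^sup>2) * (r / (1 - r))"
      unfolding y_def a_def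
      by (rule bohr_majorant_partial_sums[where b = "\<lambda>k. norm (p k)"])
        (use slice_coeff_bound_odd[OF f b] slice_coeff_bound_even[OF f b] r in auto)
    also have "\<dots> \<le> (1 - a\<^sup>2) * (m / 2)"
      using R a by (intro mult_left_mono) (auto simp: power_le_one)
    finally show ?thesis .
  qed
  \<comment> \<open>The linear series is followed along its even partial sums only, matching the
    pairing in the majorant bound.\<close>
  have "(\<lambda>N. (\<Sum>k<2*N. x k) + (1 / (1 + a) + \<omega> / (1 - \<omega>)) * (\<Sum>k<N. (x k)\<^sup>2))
      \<longlonglongrightarrow> suminf x + (1 / (1 + a) + \<omega> / (1 - \<omega>)) * (\<Sum>k. (x k)\<^sup>2)"
  proof (intro tendsto_intros)
    show "(\<lambda>N. \<Sum>k<2*N. x k) \<longlonglongrightarrow> suminf x"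
      using LIMSEQ_subseq_LIMSEQ[OF summable_LIMSEQ[OF sx], of "\<lambda>N. 2 * N"]
      by (simp add: strict_mono_def o_def)
  qed (rule summable_LIMSEQ[OF sx2])
  hence "suminf x + (1 / (1 + a) + \<omega> / (1 - \<omega>)) * (\<Sum>k. (x k)\<^sup>2) \<le> (1 - a\<^sup>2) * (m / 2)"
    by (rule LIMSEQ_le_const2) (use fin in auto)
  moreover have "a powr m + (1 - a\<^sup>2) * (m / 2) \<le> 1"
    using m a by (rule powr_plus_half_le_1)
  ultimately have "a powr m + suminf x + (1 / (1 + a) + \<omega> / (1 - \<omega>)) * (\<Sum>k. (x k)\<^sup>2) \<le> 1"
    by linarith
  with sx sx2 show ?thesis
    unfolding bohr_ineq_def x_def a_def \<omega>_def by blast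
qed

section \<open>Slice regularity and the Schwarz lemma\<close>

lemma mem_slice_dom_iff: "I \<in> imag_units \<Longrightarrow> (x, y) \<in> slice_dom I \<longleftrightarrow> norm (Complex x y) < 1"
  using norm_slice_embed[of I "Complex x y"] by (simp add: slice_dom_def slice_embed_def)

text \<open>Continuity of a partial derivative upgrades the partials to a total real differential on
  a small square. The Cauchy-Riemann equation then turns this differential into left multiplication
  of the slice derivative by elements of the slice.\<close>

lemma slice_regular_has_derivative:
  assumes f: "slice_regular f" and I: "I \<in> imag_units" and z: "norm z < 1"
  shows "((\<lambda>z. f (slice_embed I z)) has_derivative
    (\<lambda>h. slice_embed I h * slice_deriv f (slice_embed I z))) (at z)"
proof -
  \<comment> \<open>With this half-width, a point of the square is at distance less than 1 - |z|
    from z, so it stays in the disc.\<close>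
  define x y e where "x = Re z" and "y = Im z" and "e = (1 - norm z) / 2"
  have e: "e > 0" using z by (simp add: e_def)
  define X Y where "X = ball x e" and "Y = ball y e"
  have XY: "X \<times> Y \<subseteq> slice_dom I"
  proof clarify
    fix s t assume "s \<in> X" "t \<in> Y"
    hence "\<bar>s - x\<bar> < e" "\<bar>t - y\<bar> < e" by (auto simp: X_def Y_def dist_real_def abs_minus_commute)
    moreover have "norm (Complex s t - z) \<le> \<bar>s - x\<bar> + \<bar>t - y\<bar>"
      using cmod_le[of "Complex s t - z"] by (simp add: x_def y_def)
    ultimately have "norm (Complex s t - z) < 1 - norm z" by (simp add: e_def)
    hence "norm (Complex s t) < 1" using norm_triangle_sub[of "Complex s t" z] by linarith
    thus "(s, t) \<in> slice_dom I" by (simp add: mem_slice_dom_iff I)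
  qed
  have xy: "(x, y) \<in> X \<times> Y" using e by (simp add: X_def Y_def)
  have op: "open (X \<times> Y)" by (simp add: X_def Y_def open_Times)
  have dom: "(x, y) \<in> slice_dom I" using xy XY by blast
  define px py where "px = partial_x f I x y" and "py = partial_y f I x y"
  have D: "((\<lambda>(s, t). f (slice_point I s t)) has_derivative
      (\<lambda>(tx, ty). tx *\<^sub>R px + blinfun_scaleR_left (partial_y f I x y) ty)) (at (x, y) within X \<times> Y)"
  proof (rule has_derivative_partialsI)
    have "(\<lambda>t. f (slice_point I t y)) differentiable (at x)"
      using f I dom unfolding slice_regular_def by fast
    thus "((\<lambda>t. f (slice_point I t y)) has_derivative (\<lambda>tx. tx *\<^sub>R px)) (at x within X)"
      unfolding px_def partial_x_def vector_derivative_works has_vector_derivative_def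
      by (rule has_derivative_at_withinI)
    show "((\<lambda>t. f (slice_point I s t)) has_derivative blinfun_scaleR_left (partial_y f I s t)) (at t within Y)"
      if "s \<in> X" "t \<in> Y" for s t
    proof -
      have "(s, t) \<in> slice_dom I" using that XY by blast
      hence "(\<lambda>t. f (slice_point I s t)) differentiable (at t)"
        using f I unfolding slice_regular_def by fast
      thus ?thesis
        unfolding partial_y_def vector_derivative_works has_vector_derivative_def
        by (simp add: has_derivative_at_withinI)
    qed
    have "continuous_on (slice_dom I) (\<lambda>(s, t). partial_y f I s t)"
      using f I unfolding slice_regular_def by blast
    hence "continuous_on (X \<times> Y) (\<lambda>(s, t). partial_y f I s t)"
      by (rule continuous_on_subset[OF _ XY])
    hence "continuous_on (X \<times> Y) (\<lambda>p. blinfun_scaleR_left ((\<lambda>(s, t). partial_y f I s t) p))"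
      by (intro bounded_linear.continuous_on[OF bounded_linear_blinfun_scaleR_left])
    thus "continuous (at (x, y) within X \<times> Y) (\<lambda>(s, t). blinfun_scaleR_left (partial_y f I s t))"
      using xy unfolding case_prod_beta by (auto simp: continuous_on_eq_continuous_within case_prod_beta)
    show "y \<in> Y" "convex Y" using xy by (auto simp: Y_def)
  qed
  hence D: "((\<lambda>(s, t). f (slice_point I s t)) has_derivative
      (\<lambda>(tx, ty). tx *\<^sub>R px + ty *\<^sub>R py)) (at (x, y))"
    using at_within_open[OF xy op] by (simp add: py_def)
  have "((\<lambda>z. (Re z, Im z)) has_derivative (\<lambda>h. (Re h, Im h))) (at z)"
    by (intro derivative_eq_intros) auto
  from diff_chain_at[OF this, of "\<lambda>(s, t). f (slice_point I s t)" "\<lambda>(tx, ty). tx *\<^sub>R px + ty *\<^sub>R py"] D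
  have "((\<lambda>z. f (slice_embed I z)) has_derivative (\<lambda>h. Re h *\<^sub>R px + Im h *\<^sub>R py)) (at z)"
    by (simp add: o_def x_def y_def slice_embed_def)
  moreover have cr: "I * py = - px"
  proof -
    have "(1/2) *\<^sub>R (px + I * py) = 0"
      using f I dom unfolding slice_regular_def px_def py_def by fast
    thus ?thesis by (simp add: add_eq_0_iff)
  qed
  moreover have "py = I * px"
  proof -
    have "I * (I * py) = - (I * px)" unfolding cr by simp
    thus ?thesis by (simp add: imag_unit_square[OF I] flip: mult.assoc)
  qed
  moreover have "slice_deriv f (slice_embed I z) = px"
    using slice_deriv_eq[OF f I dom] cr
    by (simp add: slice_embed_def x_def y_def px_def py_def flip: scaleR_2)
  ultimately show ?thesis by (simp add: slice_embed_eq distrib_right)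
qed

text \<open>A converse that also identifies the slice derivative. In the directions 1 and i the
  differential gives the partials d and I d; then d + I (I d) = 0, and half of d - I (I d) is
  d.\<close>

lemma slice_regularI:
  assumes der: "\<And>I z. I \<in> imag_units \<Longrightarrow> norm z < 1 \<Longrightarrow>
      ((\<lambda>z. f (slice_embed I z)) has_derivative (\<lambda>h. slice_embed I h * d I z)) (at z)"
    and cont: "\<And>I. I \<in> imag_units \<Longrightarrow> continuous_on (ball 0 1) (d I)"
  shows "slice_regular f"
    and "\<And>I z. I \<in> imag_units \<Longrightarrow> norm z < 1 \<Longrightarrow> slice_deriv f (slice_embed I z) = d I z"
proof -
  have emb: "slice_point I x y = slice_embed I (Complex x y)" for I x y
    by (simp add: slice_embed_def)
  have vx: "((\<lambda>t. f (slice_point I t y)) has_vector_derivative d I (Complex x y)) (at x)"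
    and vy: "((\<lambda>t. f (slice_point I x t)) has_vector_derivative I * d I (Complex x y)) (at y)"
    if I: "I \<in> imag_units" and "(x, y) \<in> slice_dom I" for I x y
  proof -
    have n: "norm (Complex x y) < 1" using that by (simp add: mem_slice_dom_iff)
    have "((\<lambda>t. Complex t y) has_derivative (\<lambda>h. Complex h 0)) (at x)"
      by (auto simp: Complex_eq intro!: derivative_eq_intros)
    from diff_chain_at[OF this der[OF I n]]
    show "((\<lambda>t. f (slice_point I t y)) has_vector_derivative d I (Complex x y)) (at x)"
      by (simp add: o_def emb has_vector_derivative_def slice_embed_eq)
    have "((\<lambda>t. Complex x t) has_derivative (\<lambda>h. Complex 0 h)) (at y)"
      by (auto simp: Complex_eq intro!: derivative_eq_intros)
    from diff_chain_at[OF this der[OF I n]]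
    show "((\<lambda>t. f (slice_point I x t)) has_vector_derivative I * d I (Complex x y)) (at y)"
      by (simp add: o_def emb has_vector_derivative_def slice_embed_eq)
  qed
  have px: "partial_x f I x y = d I (Complex x y)" and py: "partial_y f I x y = I * d I (Complex x y)"
    if "I \<in> imag_units" "(x, y) \<in> slice_dom I" for I x y
    unfolding partial_x_def partial_y_def
    using vx[OF that] vy[OF that] by (auto intro: vector_derivative_at)
  have contd: "continuous_on (slice_dom I) (\<lambda>(x, y). d I (Complex x y))" if I: "I \<in> imag_units" for I
  proof -
    have "continuous_on (slice_dom I) (\<lambda>p. d I ((\<lambda>(x, y). Complex x y) p))"
      by (rule continuous_on_compose2[OF cont[OF I]])
        (auto simp: mem_slice_dom_iff I Complex_eq case_prod_beta intro!: continuous_intros)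
    thus ?thesis by (simp add: case_prod_beta)
  qed
  show reg: "slice_regular f"
    unfolding slice_regular_def
  proof (intro ballI conjI)
    fix I assume I: "I \<in> imag_units"
    show "case p of (x, y) \<Rightarrow> (\<lambda>t. f (slice_point I t y)) differentiable (at x) \<and>
                          (\<lambda>t. f (slice_point I x t)) differentiable (at y)" if "p \<in> slice_dom I" for p
      using that by (auto intro: differentiableI_vector[OF vx[OF I]] differentiableI_vector[OF vy[OF I]])
    show "continuous_on (slice_dom I) (\<lambda>(x, y). partial_x f I x y)"
      by (rule continuous_on_eq[OF contd[OF I]]) (auto simp: px I)
    have "continuous_on (slice_dom I) (\<lambda>p. I * (\<lambda>(x, y). d I (Complex x y)) p)"
      by (intro continuous_intros contd[OF I])
    thus "continuous_on (slice_dom I) (\<lambda>(x, y). partial_y f I x y)"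
      by (rule continuous_on_eq) (auto simp: py I)
    show "case p of (x, y) \<Rightarrow> (1/2) *\<^sub>R (partial_x f I x y + I * partial_y f I x y) = 0" if "p \<in> slice_dom I" for p
      using that by (auto simp: px py I imag_unit_square simp flip: mult.assoc)
  qed
  show "slice_deriv f (slice_embed I z) = d I z" if I: "I \<in> imag_units" and z: "norm z < 1" for I z
  proof -
    have dom: "(Re z, Im z) \<in> slice_dom I" using that by (simp add: mem_slice_dom_iff)
    show ?thesis
      using slice_deriv_eq[OF reg I dom]
      by (simp add: px[OF I dom] py[OF I dom] slice_embed_def imag_unit_square[OF I] flip: mult.assoc scaleR_2)
  qed
qed

text \<open>
  The functional that is complex linear for left multiplication by \<open>\<C>\<^sub>I\<close> and has real part
  \<open>\<langle>q, v\<rangle>\<close>. It turns a slice regular function into a holomorphic one without a choice of \<open>J \<bottom> I\<close>.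
\<close>

definition slice_functional :: "quat \<Rightarrow> quat \<Rightarrow> quat \<Rightarrow> complex"
  where "slice_functional I v q = Complex (inner q v) (- inner (I * q) v)"

lemma slice_functional_0 [simp]: "slice_functional I v 0 = 0"
  by (simp add: slice_functional_def complex_eq_iff)

lemma slice_functional_mult:
  assumes "I \<in> imag_units"
  shows "slice_functional I v (slice_embed I h * q) = h * slice_functional I v q"
proof -
  have "I * (I * q) = - q"
    using imag_unit_square[OF assms] by (simp flip: mult.assoc)
  thus ?thesis
    by (simp add: slice_functional_def slice_embed_eq complex_eq_iff distrib_right distrib_left
        inner_add_left algebra_simps)
qed

lemma inner_imag_unit_mult:
  "I \<in> imag_units \<Longrightarrow> inner (I * q) v = - inner q (I * v)"
  by (simp add: imag_units_iff inner_quat_def algebra_simps)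

text \<open>Bessel's inequality: the two components are inner products of q with v and I v, which
  are orthogonal and of equal norm. It is obtained by Cauchy-Schwarz against the matching
  combination of v and I v.\<close>

lemma norm_slice_functional_le:
  assumes "I \<in> imag_units"
  shows "norm (slice_functional I v q) \<le> norm q * norm v"
proof -
  define s t where "s = inner q v" and "t = inner q (I * v)"
  have orth: "inner v (I * v) = 0" "inner (I * v) v = 0"
    using inner_imag_unit_mult[OF assms, of v v] by (simp_all add: inner_commute)
  have nIv: "norm (I * v) = norm v" by (simp add: norm_mult norm_imag_unit[OF assms])
  have n: "(norm (s *\<^sub>R v + t *\<^sub>R (I * v)))\<^sup>2 = (s\<^sup>2 + t\<^sup>2) * (norm v)\<^sup>2"
  proof -
    have "inner (I * v) (I * v) = inner v v"
      using nIv by (metis power2_norm_eq_inner)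
    with orth show ?thesis
      unfolding power2_norm_eq_inner
      by (simp add: inner_add_left inner_add_right power2_eq_square algebra_simps)
  qed
  have "s\<^sup>2 + t\<^sup>2 = inner q (s *\<^sub>R v + t *\<^sub>R (I * v))"
    by (simp add: s_def t_def inner_add_right power2_eq_square)
  also have "\<dots> \<le> norm q * norm (s *\<^sub>R v + t *\<^sub>R (I * v))" by (rule norm_cauchy_schwarz)
  also have "norm (s *\<^sub>R v + t *\<^sub>R (I * v)) = sqrt (s\<^sup>2 + t\<^sup>2) * norm v"
    using n by (metis norm_ge_zero real_sqrt_abs real_sqrt_mult abs_of_nonneg)
  finally have le: "sqrt (s\<^sup>2 + t\<^sup>2) * sqrt (s\<^sup>2 + t\<^sup>2) \<le> (norm q * norm v) * sqrt (s\<^sup>2 + t\<^sup>2)"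
    by (simp add: mult_ac)
  have "sqrt (s\<^sup>2 + t\<^sup>2) \<le> norm q * norm v"
  proof (cases "sqrt (s\<^sup>2 + t\<^sup>2) > 0")
    case True
    show ?thesis by (rule mult_right_le_imp_le[OF le True])
  next
    case False
    hence "sqrt (s\<^sup>2 + t\<^sup>2) \<le> 0" by simp
    also have "0 \<le> norm q * norm v" by simp
    finally show ?thesis .
  qed
  thus ?thesis
    by (simp add: slice_functional_def cmod_def inner_imag_unit_mult[OF assms] s_def t_def)
qed

lemma slice_functional_self:
  assumes "I \<in> imag_units"
  shows "slice_functional I q q = of_real ((norm q)\<^sup>2)"
  using inner_imag_unit_mult[OF assms, of q q]
  by (simp add: slice_functional_def complex_eq_iff power2_norm_eq_inner inner_commute)

lemma bounded_linear_slice_functional: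
  assumes "I \<in> imag_units"
  shows "bounded_linear (slice_functional I v)"
  by (rule bounded_linear_intro[where K = "norm v"])
    (use norm_slice_functional_le[OF assms] in
      \<open>auto simp: slice_functional_def complex_eq_iff distrib_left inner_add_left\<close>)

section \<open>Holomorphic components and iterated slice derivatives\<close>

definition quat_basis :: "nat \<Rightarrow> quat"
  where "quat_basis n = [1, Quat 0 1 0 0, Quat 0 0 1 0, Quat 0 0 0 1] ! n"

text \<open>The real parts rebuild q from the orthonormal basis, and the imaginary parts contribute
  - I (I q) = q. Four functionals on a complex plane of dimension two count every vector twice,
  hence the factor 1/2.\<close>

lemma slice_functional_frame:
  assumes "I \<in> imag_units"
  shows "(1/2) *\<^sub>R (\<Sum>n<4. slice_embed I (slice_functional I (quat_basis n) q) * quat_basis n) = q"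
proof -
  have basis: "(\<Sum>n<4. inner x (quat_basis n) *\<^sub>R quat_basis n) = x" for x
    by (simp add: eval_nat_numeral quat_basis_def quat_eq_iff inner_quat_def)
  have "(\<Sum>n<4. slice_embed I (slice_functional I (quat_basis n) q) * quat_basis n) =
      (\<Sum>n<4. inner q (quat_basis n) *\<^sub>R quat_basis n)
      - I * (\<Sum>n<4. inner (I * q) (quat_basis n) *\<^sub>R quat_basis n)"
    by (simp add: slice_functional_def slice_embed_eq sum_distrib_left left_diff_distrib flip: sum_subtractf)
  also have "\<dots> = 2 *\<^sub>R q"
    unfolding basis using imag_unit_square[OF assms] by (simp add: scaleR_2 flip: mult.assoc)
  finally show ?thesis by simp
qed

lemma slice_functional_has_field_derivative:
  assumes "slice_regular f" and I: "I \<in> imag_units" and "norm z < 1"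
  shows "((\<lambda>z. slice_functional I v (f (slice_embed I z))) has_field_derivative
    slice_functional I v (slice_deriv f (slice_embed I z))) (at z)"
  unfolding has_field_derivative_def
  using bounded_linear.has_derivative[OF bounded_linear_slice_functional[OF I] slice_regular_has_derivative[OF assms], of v]
  by (rule has_derivative_eq_rhs) (simp add: slice_functional_mult[OF I] fun_eq_iff)

text \<open>On a slice the four components of f are holomorphic. Their derivatives are again
  holomorphic and are the components of the slice derivative, which the frame formula
  reassembles.\<close>

lemma slice_regular_slice_deriv:
  assumes f: "slice_regular f"
  shows "slice_regular (slice_deriv f)"
proof -
  define H where "H I n z = slice_functional I (quat_basis n) (f (slice_embed I z))" for I n z
  have hol: "H I n holomorphic_on ball 0 1" if "I \<in> imag_units" for I n
    unfolding H_def[abs_def]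
    by (rule holomorphic_onI)
      (use slice_functional_has_field_derivative[OF f that] in
        \<open>auto simp: field_differentiable_def intro: has_field_derivative_at_within\<close>)
  have dH: "deriv (H I n) z = slice_functional I (quat_basis n) (slice_deriv f (slice_embed I z))"
    if "I \<in> imag_units" "norm z < 1" for I n z
    unfolding H_def[abs_def] by (intro DERIV_imp_deriv slice_functional_has_field_derivative f that)
  show ?thesis
  proof (rule slice_regularI(1))
    fix I z assume I: "I \<in> imag_units" and z: "norm (z::complex) < 1"
    have "(deriv (H I n) has_field_derivative deriv (deriv (H I n)) z) (at z)" for n
      using holomorphic_deriv[OF hol[OF I]] z by (intro holomorphic_derivI[where S = "ball 0 1"]) auto
    hence d1: "((\<lambda>z. slice_embed I (deriv (H I n) z)) has_derivative
        (\<lambda>h. slice_embed I (deriv (deriv (H I n)) z * h))) (at z)" for n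
      unfolding has_field_derivative_def
      by (rule bounded_linear.has_derivative[OF bounded_linear_slice_embed[OF I]])
    have "((\<lambda>z. (1/2) *\<^sub>R (\<Sum>n<4. slice_embed I (deriv (H I n) z) * quat_basis n)) has_derivative
        (\<lambda>h. (1/2) *\<^sub>R (\<Sum>n<4. slice_embed I (deriv (deriv (H I n)) z * h) * quat_basis n))) (at z)"
      by (intro has_derivative_scaleR_right has_derivative_sum has_derivative_mult_left d1)
    moreover have "(\<lambda>h. (1/2) *\<^sub>R (\<Sum>n<4. slice_embed I (deriv (deriv (H I n)) z * h) * quat_basis n))
        = (\<lambda>h. slice_embed I h * ((1/2) *\<^sub>R (\<Sum>n<4. slice_embed I (deriv (deriv (H I n)) z) * quat_basis n)))"
      by (simp add: sum_distrib_left slice_embed_mult[OF I] mult.assoc mult.commute[where 'a = complex])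
    ultimately have "((\<lambda>z. (1/2) *\<^sub>R (\<Sum>n<4. slice_embed I (deriv (H I n) z) * quat_basis n)) has_derivative
        (\<lambda>h. slice_embed I h * ((1/2) *\<^sub>R (\<Sum>n<4. slice_embed I (deriv (deriv (H I n)) z) * quat_basis n)))) (at z)"
      by simp
    thus "((\<lambda>z. slice_deriv f (slice_embed I z)) has_derivative
        (\<lambda>h. slice_embed I h * ((1/2) *\<^sub>R (\<Sum>n<4. slice_embed I (deriv (deriv (H I n)) z) * quat_basis n)))) (at z)"
      by (rule has_derivative_transform_within_open[where s = "ball 0 1"])
        (use z in \<open>auto simp: dH[OF I] slice_functional_frame[OF I] simp del: scaleR_half_double\<close>)
  next
    fix I assume I: "I \<in> imag_units"
    have "continuous_on (ball 0 1) (deriv (deriv (H I n)))" for n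
      by (intro holomorphic_on_imp_continuous_on holomorphic_deriv hol I) auto
    thus "continuous_on (ball 0 1) (\<lambda>z. (1/2) *\<^sub>R (\<Sum>n<4. slice_embed I (deriv (deriv (H I n)) z) * quat_basis n))"
      by (intro continuous_intros bounded_linear.continuous_on[OF bounded_linear_slice_embed[OF I]])
  qed
qed

lemma slice_regular_funpow: "slice_regular f \<Longrightarrow> slice_regular ((slice_deriv ^^ j) f)"
  by (induction j) (auto intro: slice_regular_slice_deriv)

text \<open>Transfers the vanishing slice derivatives at 0 in the definition of \<open>SB_n\<close>
  to the order of the zero of a holomorphic component.\<close>

lemma higher_deriv_slice_functional:
  assumes f: "slice_regular f" and I: "I \<in> imag_units" and "norm z < 1"
  shows "(deriv ^^ j) (\<lambda>z. slice_functional I v (f (slice_embed I z))) z =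
    slice_functional I v ((slice_deriv ^^ j) f (slice_embed I z))"
  using assms(3)
proof (induction j arbitrary: z)
  case (Suc j)
  have "((\<lambda>z. slice_functional I v ((slice_deriv ^^ j) f (slice_embed I z))) has_field_derivative
      slice_functional I v ((slice_deriv ^^ Suc j) f (slice_embed I z))) (at z)"
    using slice_functional_has_field_derivative[OF slice_regular_funpow[OF f] I Suc.prems] by simp
  hence "((deriv ^^ j) (\<lambda>z. slice_functional I v (f (slice_embed I z))) has_field_derivative
      slice_functional I v ((slice_deriv ^^ Suc j) f (slice_embed I z))) (at z)"
    by (rule has_field_derivative_transform_within_open[where S = "ball 0 1"])
      (use Suc in auto)
  thus ?case by (simp add: DERIV_imp_deriv)
qed simp

section \<open>Schwarz lemma for zeros of higher order\<close>

text \<open>Dividing by z^k leaves a holomorphic function of modulus at most 1 / r^k on the circle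
  of radius r. Apply the maximum principle and let r tend to 1.\<close>

lemma schwarz_higher_order:
  assumes hol: "h holomorphic_on ball 0 1" and le: "\<And>z. norm z < 1 \<Longrightarrow> norm (h z) \<le> 1"
    and zero: "\<And>j. j < k \<Longrightarrow> (deriv ^^ j) h 0 = 0" and z: "norm z < 1"
  shows "norm (h z) \<le> norm z ^ k"
proof -
  define a where "a n = (deriv ^^ n) h 0 / fact n" for n
  \<comment> \<open>The value at 0 fills the removable singularity; the shifted power series proves
    holomorphy.\<close>
  define g where "g z = (if z = 0 then a k else h z / z ^ k)" for z
  have ser: "(\<lambda>n. a n * z ^ n) sums h z" if "norm z < 1" for z
    using holomorphic_power_series[OF hol, of z] that by (simp add: a_def)
  have "(\<lambda>n. a (n + k) * (z - 0) ^ n) sums g z" if "z \<in> ball 0 1" for z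
  proof (cases "z = 0")
    case True
    thus ?thesis using sums_finite[of "{0}" "\<lambda>n. a (n + k) * 0 ^ n"] by (simp add: g_def)
  next
    case False
    have "(\<lambda>n. a (n + k) * z ^ (n + k)) sums (h z - (\<Sum>n<k. a n * z ^ n))"
      using ser[of z] that by (intro sums_split_initial_segment) auto
    moreover have "(\<Sum>n<k. a n * z ^ n) = 0" using zero by (simp add: a_def)
    ultimately have "(\<lambda>n. a (n + k) * z ^ (n + k) / z ^ k) sums (h z / z ^ k)"
      by (intro sums_divide) simp
    thus ?thesis using False by (simp add: g_def power_add)
  qed
  hence g: "g holomorphic_on ball 0 1" by (rule power_series_holomorphic)
  have hg: "h z = z ^ k * g z"
    using ser[of 0] sums_finite[of "{0}" "\<lambda>n. a n * 0 ^ n"] zero[of 0]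
    by (cases "k = 0") (auto simp: g_def power_0_left a_def dest: sums_unique2)
  \<comment> \<open>With r^k as a factor on the left, the claim is also true for r \<le> |z| and is
    continuous at r = 1.\<close>
  have "norm (h z) * r ^ k \<le> norm z ^ k" if r: "0 < r" "r < 1" for r
  proof (cases "norm z < r")
    case True
    have "norm (g z) \<le> 1 / r ^ k"
    proof (rule maximum_modulus_frontier[where f = g and S = "cball 0 r"])
      show "g holomorphic_on interior (cball 0 r)" 
        using r by (intro holomorphic_on_subset[OF g]) auto
      show "continuous_on (closure (cball 0 r)) g"
        using r by (intro holomorphic_on_imp_continuous_on holomorphic_on_subset[OF g]) auto
      show "norm (g x) \<le> 1 / r ^ k" if "x \<in> frontier (cball 0 r)" for x
      proof -
        have "norm x = r" using that r by (simp add: frontier_cball)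
        thus ?thesis using r le[of x] by (auto simp: g_def norm_divide norm_power divide_right_mono)
      qed
    qed (use True in auto)
    hence "norm (g z) * r ^ k \<le> 1" using r by (simp add: field_simps)
    thus ?thesis
      unfolding hg using mult_left_mono[of "norm (g z) * r ^ k" 1 "norm z ^ k"]
      by (simp add: norm_mult norm_power mult.assoc)
  next
    case False
    have "norm (h z) * r ^ k \<le> 1 * norm z ^ k"
      using False r le[OF z] by (intro mult_mono power_mono) auto
    thus ?thesis by simp
  qed
  hence "norm (h z) * 1 ^ k \<le> norm z ^ k"
    by (rule le_at_1_if_le_left) (auto intro!: continuous_intros)
  thus ?thesis by simp
qed

text \<open>Take v as the phase of w at the given point q. The holomorphic component along v is
  bounded by 1 on the slice and equals |w(q)| at q, so the complex Schwarz lemma suffices.\<close>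

lemma SB_n_norm_le:
  assumes w: "w \<in> SB_n n" and q: "norm q < 1"
  shows "norm (w q) \<le> norm q ^ n"
proof (cases "w q = 0")
  case False
  have reg: "slice_regular w" and le: "\<And>q. norm q < 1 \<Longrightarrow> norm (w q) \<le> 1"
    and zero: "\<And>j. j < n \<Longrightarrow> (slice_deriv ^^ j) w 0 = 0"
    using w by (auto simp: SB_n_def SB_def less_imp_le)
  obtain I z where I: "I \<in> imag_units" and qz: "q = slice_embed I z" by (rule quat_in_slice)
  have z: "norm z < 1" using q by (simp add: qz norm_slice_embed[OF I])
  define v where "v = sgn (w q)"
  have v: "norm v = 1" using False by (simp add: v_def norm_sgn)
  define h where "h z = slice_functional I v (w (slice_embed I z))" for z
  have "norm (h z) \<le> norm z ^ n"
  proof (rule schwarz_higher_order)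
    show "h holomorphic_on ball 0 1"
      unfolding h_def[abs_def]
      by (rule holomorphic_onI)
        (use slice_functional_has_field_derivative[OF reg I] in
          \<open>auto simp: field_differentiable_def intro: has_field_derivative_at_within\<close>)
    show "norm (h z) \<le> 1" if "norm z < 1" for z
      using norm_slice_functional_le[OF I, of v "w (slice_embed I z)"] le[of "slice_embed I z"] that
      by (simp add: h_def v norm_slice_embed[OF I])
    show "(deriv ^^ j) h 0 = 0" if "j < n" for j
      unfolding h_def[abs_def] using higher_deriv_slice_functional[OF reg I, of 0 j v] zero[OF that]
      by simp
  qed (rule z)
  moreover have "h z = of_real (norm (w q))"
  proof -
    have "w q = norm (w q) *\<^sub>R v" using False by (simp add: v_def sgn_div_norm)
    hence "h z = norm (w q) *\<^sub>R slice_functional I v v"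
      unfolding h_def qz[symmetric]
      by (metis bounded_linear.linear bounded_linear_slice_functional[OF I] linear_scale)
    thus ?thesis by (simp add: slice_functional_self[OF I] v scaleR_conv_of_real)
  qed
  ultimately show ?thesis by (simp add: qz norm_slice_embed[OF I])
qed simp

section \<open>Sharpness\<close>

text \<open>The formula for f is required only on the ball, so that the lemma also applies to
  iterated slice derivatives. The truncated exponent at k = 0 is harmless, as its coefficient is
  0.\<close>

lemma slice_polynomial:
  assumes A: "finite A" and f: "\<And>q. norm q < 1 \<Longrightarrow> f q = (\<Sum>k\<in>A. q ^ k * c k)"
  shows "slice_regular f"
    and "\<And>q. norm q < 1 \<Longrightarrow> slice_deriv f q = (\<Sum>k\<in>A. q ^ (k - 1) * (real k *\<^sub>R c k))"
proof -
  define d where "d I z = (\<Sum>k\<in>A. slice_embed I z ^ (k - 1) * (real k *\<^sub>R c k))" for I z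
  have der: "((\<lambda>z. f (slice_embed I z)) has_derivative (\<lambda>h. slice_embed I h * d I z)) (at z)"
    if I: "I \<in> imag_units" and z: "norm z < 1" for I z
  proof -
    have "((\<lambda>z. slice_embed I (z ^ k)) has_derivative (\<lambda>h. slice_embed I (of_nat k * h * z ^ (k - 1)))) (at z)" for k
      by (rule bounded_linear.has_derivative[OF bounded_linear_slice_embed[OF I]])
        (auto intro!: derivative_eq_intros)
    hence "((\<lambda>z. \<Sum>k\<in>A. slice_embed I (z ^ k) * c k) has_derivative
        (\<lambda>h. \<Sum>k\<in>A. slice_embed I (of_nat k * h * z ^ (k - 1)) * c k)) (at z)"
      by (intro has_derivative_sum has_derivative_mult_left)
    moreover have "(\<lambda>h. \<Sum>k\<in>A. slice_embed I (of_nat k * h * z ^ (k - 1)) * c k) = (\<lambda>h. slice_embed I h * d I z)"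
    proof
      fix h
      have "slice_embed I (of_nat k * h * z ^ (k - 1)) =
          real k *\<^sub>R (slice_embed I h * slice_embed I z ^ (k - 1))" for k
      proof -
        have "of_nat k * h * z ^ (k - 1) = real k *\<^sub>R (h * z ^ (k - 1))"
          by (simp add: scaleR_conv_of_real)
        thus ?thesis by (simp only: slice_embed_scaleR slice_embed_mult[OF I] slice_embed_power[OF I])
      qed
      thus "(\<Sum>k\<in>A. slice_embed I (of_nat k * h * z ^ (k - 1)) * c k) = slice_embed I h * d I z"
        by (simp add: d_def sum_distrib_left mult.assoc)
    qed
    ultimately have "((\<lambda>z. \<Sum>k\<in>A. slice_embed I (z ^ k) * c k) has_derivative (\<lambda>h. slice_embed I h * d I z)) (at z)"
      by simp
    thus ?thesis
      by (rule has_derivative_transform_within_open[where s = "ball 0 1"])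
        (use z in \<open>auto simp: f norm_slice_embed[OF I] slice_embed_power[OF I]\<close>)
  qed
  have cont: "continuous_on (ball 0 1) (d I)" if "I \<in> imag_units" for I
    unfolding d_def[abs_def]
    by (intro continuous_intros bounded_linear.continuous_on[OF bounded_linear_slice_embed[OF that]])
  show "slice_regular f" by (rule slice_regularI(1)[OF der cont])
  show "slice_deriv f q = (\<Sum>k\<in>A. q ^ (k - 1) * (real k *\<^sub>R c k))" if q: "norm q < 1" for q
  proof -
    obtain I z where I: "I \<in> imag_units" and qz: "q = slice_embed I z" by (rule quat_in_slice)
    have "slice_deriv f (slice_embed I z) = d I z"
      by (rule slice_regularI(2)[OF der cont I]) (use q in \<open>simp_all add: qz norm_slice_embed[OF I]\<close>)
    thus ?thesis by (simp add: d_def qz)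
  qed
qed

lemma slice_deriv_funpow_monomial:
  assumes "norm q < 1" and "j \<le> n"
  shows "(slice_deriv ^^ j) (\<lambda>q. q ^ n * c) q = q ^ (n - j) * ((fact n / fact (n - j)) *\<^sub>R c)"
  using assms
proof (induction j arbitrary: q)
  case (Suc j)
  define b :: real where "b = fact n / fact (n - j)"
  have "slice_deriv ((slice_deriv ^^ j) (\<lambda>q. q ^ n * c)) q =
      (\<Sum>k\<in>{n - j}. q ^ (k - 1) * (real k *\<^sub>R (b *\<^sub>R c)))"
    by (rule slice_polynomial(2)) (use Suc in \<open>auto simp: b_def\<close>)
  moreover have "real (n - j) * b = fact n / fact (n - Suc j)"
  proof -
    have "n - j = Suc (n - Suc j)" using Suc.prems by simp
    thus ?thesis by (simp add: b_def del: of_nat_Suc)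
  qed
  ultimately show ?case by simp
qed simp

lemma monomial_in_SB_n:
  assumes c: "0 < c" "c < 1"
  shows "(\<lambda>q. q ^ n * of_real c) \<in> SB_n n"
proof -
  have reg: "slice_regular (\<lambda>q. q ^ n * of_real c)"
    by (rule slice_polynomial(1)[where A = "{n}" and c = "\<lambda>_. of_real c"]) auto
  have "norm (q ^ n * of_real c :: quat) < 1" if "norm q \<le> 1" for q :: quat
  proof -
    have "norm q ^ n * c \<le> 1 * c"
      using that c by (intro mult_right_mono) (auto simp: power_le_one)
    also have "\<dots> < 1" using c by simp
    finally show ?thesis using c by (simp add: norm_mult norm_power)
  qed
  hence "(\<lambda>q. q ^ n * of_real c) \<in> SB"
    using reg by (auto simp: SB_def intro!: continuous_intros)
  thus ?thesis
    using c by (auto simp: SB_n_def slice_deriv_funpow_monomial power_0_left)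
qed

section \<open>The extremal family\<close>

text \<open>The full kernel (1 + u) / (1 - u) has real part (1 - |u|^2) / |1 - u|^2, which is at
  least (1 - \<rho>) / (1 + \<rho>) and so at least 2 \<delta>. The omitted tail costs at most
  \<delta>.\<close>

lemma truncated_herglotz_kernel_Re_ge:
  fixes z :: complex
  assumes \<rho>: "0 < \<rho>" "\<rho> < 1" and z: "norm z \<le> 1"
    and N: "2 * \<rho> ^ Suc N / (1 - \<rho>) \<le> \<delta>" and \<delta>: "2 * \<delta> \<le> (1 - \<rho>) / (1 + \<rho>)"
  shows "\<delta> \<le> Re (1 + 2 * (\<Sum>k<N. (of_real \<rho> * z) ^ Suc k))"
proof -
  define u where "u = of_real \<rho> * z"
  have u: "norm u \<le> \<rho>" using z \<rho> by (simp add: u_def norm_mult mult_left_le)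
  have n1: "norm (1 - u) \<ge> 1 - \<rho>" using norm_triangle_ineq2[of 1 u] u by simp
  have n2: "norm (1 - u) \<le> 1 + \<rho>" using norm_triangle_ineq4[of 1 u] u by simp
  have ne: "1 - u \<noteq> 0" using n1 \<rho> by auto
  have gs: "(\<Sum>k<N. u ^ Suc k) = u * (1 - u ^ N) / (1 - u)"
    using ne by (simp add: sum_gp_strict flip: sum_distrib_left)
  hence eq: "1 + 2 * (\<Sum>k<N. u ^ Suc k) = (1 + u) / (1 - u) - 2 * u ^ Suc N / (1 - u)"
  proof -
    have "1 + 2 * (u * (1 - u ^ N) / (1 - u)) = ((1 - u) + 2 * (u * (1 - u ^ N))) / (1 - u)"
      using ne by (simp only: add_divide_distrib) simp
    also have "(1 - u) + 2 * (u * (1 - u ^ N)) = (1 + u) - 2 * u ^ Suc N"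
      by (simp add: algebra_simps)
    finally show ?thesis unfolding gs by (simp only: diff_divide_distrib)
  qed
  have "Re ((1 + u) / (1 - u)) = (1 - (norm u)\<^sup>2) / (norm (1 - u))\<^sup>2"
    by (simp add: Re_divide cmod_power2) (simp add: power2_eq_square algebra_simps)
  also have "\<dots> \<ge> (1 - \<rho>\<^sup>2) / (1 + \<rho>)\<^sup>2"
    using u n2 \<rho> ne by (intro frac_le power_mono diff_mono) (auto simp: power_le_one)
  also have "(1 - \<rho>\<^sup>2) / (1 + \<rho>)\<^sup>2 = (1 - \<rho>) / (1 + \<rho>)"
  proof -
    have "1 - \<rho>\<^sup>2 = (1 - \<rho>) * (1 + \<rho>)" by (simp add: algebra_simps power2_eq_square)
    moreover have "(1 + \<rho>)\<^sup>2 = (1 + \<rho>) * (1 + \<rho>)" by (rule power2_eq_square)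
    ultimately show ?thesis using \<rho> by simp
  qed
  finally have "Re ((1 + u) / (1 - u)) \<ge> 2 * \<delta>" using \<delta> by simp
  moreover have "norm (2 * u ^ Suc N / (1 - u)) \<le> 2 * \<rho> ^ Suc N / (1 - \<rho>)"
    unfolding norm_divide norm_mult norm_power
    using u n1 \<rho> by (intro frac_le mult_mono power_mono) auto
  hence "Re (2 * u ^ Suc N / (1 - u)) \<le> \<delta>"
    using N complex_Re_le_cmod[of "2 * u ^ Suc N / (1 - u)"] by linarith
  ultimately show ?thesis unfolding u_def[symmetric] eq by simp
qed

text \<open>At q = r the first two summands are (1 - e)^m + e K, with value 1 and slope K - m at e =
  0. As t tends to 1 and N grows, K approaches 2 r / (1 - r), which exceeds m beyond the radius m /
  (m + 2).\<close>

lemma bohr_radius_sharp: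
  assumes m: "0 < m" and r: "m / (m + 2) < r" "r < 1"
  obtains f p w where "f \<in> SB" "has_slice_expansion f p" "\<And>k. w k \<in> SB_n k"
    "\<not> bohr_ineq m p w (of_real r)"
proof -
  have r0: "0 < r" using r m by (meson divide_pos_pos add_pos_pos zero_less_numeral less_trans)
  have "m < 2 * (r / (1 - r))" using r m by (simp add: field_simps)
  moreover have "((\<lambda>t. 2 * t * (t * r / (1 - t * r))) \<longlongrightarrow> 2 * 1 * (1 * r / (1 - 1 * r))) (at_left 1)"
    by (intro tendsto_intros) (use r in auto)
  ultimately have "\<forall>\<^sub>F t in at_left 1. m < 2 * t * (t * r / (1 - t * r))"
    by (intro order_tendstoD(1)) auto
  moreover have "\<forall>\<^sub>F t in at_left 1. t \<in> {0<..<1::real}"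
    by (rule eventually_at_left_real) simp
  ultimately have "\<forall>\<^sub>F t in at_left (1::real). m < 2 * t * (t * r / (1 - t * r)) \<and> 0 < t \<and> t < 1"
    by eventually_elim auto
  then obtain t where t: "m < 2 * t * (t * r / (1 - t * r))" "0 < t" "t < 1"
    using eventually_happens trivial_limit_at_left_real by blast
  \<comment> \<open>\<open>\<sigma>\<close> bounds the real part of the full kernel from below; half
    of it is reserved for the truncation error.\<close>
  define \<sigma> \<delta> where "\<sigma> = (1 - t) / (1 + t)" and "\<delta> = \<sigma> / 2"
  have \<delta>: "\<delta> > 0" using t by (simp add: \<delta>_def \<sigma>_def)
  have tr: "0 < t * r" "t * r < 1" using t r r0 mult_strict_mono[of t 1 r 1] by auto
  have "(\<lambda>k. (t * r) ^ Suc k) sums (t * r * (1 / (1 - t * r)))"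
    using sums_mult[OF geometric_sums[of "t * r"], of "t * r"] tr by simp
  hence "(\<lambda>N. 2 * t * (\<Sum>k<N. (t * r) ^ Suc k)) \<longlonglongrightarrow> 2 * t * (t * r * (1 / (1 - t * r)))"
    unfolding sums_def by (intro tendsto_intros)
  hence "\<forall>\<^sub>F N in sequentially. m < 2 * t * (\<Sum>k<N. (t * r) ^ Suc k)"
    by (rule order_tendstoD) (use t in simp)
  moreover have "(\<lambda>N. 2 * t ^ Suc N / (1 - t)) \<longlonglongrightarrow> 2 * 0 / (1 - t)"
    by (intro tendsto_intros LIMSEQ_Suc LIMSEQ_realpow_zero) (use t in auto)
  hence "\<forall>\<^sub>F N in sequentially. 2 * t ^ Suc N / (1 - t) < \<delta>"
    by (rule order_tendstoD) (use \<delta> in simp)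
  ultimately have "\<forall>\<^sub>F N in sequentially. m < 2 * t * (\<Sum>k<N. (t * r) ^ Suc k) \<and> 2 * t ^ Suc N / (1 - t) < \<delta>"
    by eventually_elim simp
  then obtain N where N: "m < 2 * t * (\<Sum>k<N. (t * r) ^ Suc k)" "2 * t ^ Suc N / (1 - t) < \<delta>"
    using eventually_happens trivial_limit_sequentially by blast
  define K where "K = 2 * t * (\<Sum>k<N. (t * r) ^ Suc k)"
  define B where "B = 1 + 2 * real N"
  have "((\<lambda>e. (1 - e) powr m + e * K) has_real_derivative K - m) (at 0)"
    by (auto intro!: derivative_eq_intros)
  moreover have "K - m > 0" using N by (simp add: K_def)
  ultimately obtain d where d: "d > 0" "\<And>h. 0 < h \<Longrightarrow> h < d \<Longrightarrow> (1 - 0) powr m + 0 * K < (1 - (0 + h)) powr m + (0 + h) * K"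
    using DERIV_pos_inc_right by blast
  \<comment> \<open>The first bound keeps e where the slope argument applies. The last makes the
    quadratic term of |1 - e P|^2 at most e \<delta>, half of the linear gain 2 e \<delta>.\<close>
  define e where "e = min (d / 2) (min (1 / 2) (\<delta> / B\<^sup>2))"
  have B: "B \<ge> 1" by (simp add: B_def)
  have e_le: "e \<le> d / 2" "e \<le> 1 / 2" "e \<le> \<delta> / B\<^sup>2"
    unfolding e_def by (rule min.cobounded1, rule min.coboundedI2[OF min.cobounded1],
      rule min.coboundedI2[OF min.cobounded2])
  have e: "0 < e" "e < d" "e < 1" "e * B\<^sup>2 \<le> \<delta>"
  proof -
    show "0 < e" using d \<delta> B by (simp add: e_def)
    show "e < d" "e < 1" using e_le d by linarith+
    show "e * B\<^sup>2 \<le> \<delta>" using e_le(3) B by (simp add: pos_le_divide_eq)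
  qed
  define a where "a k = (if k = 0 then 1 - e else if k \<le> N then - 2 * e * t ^ k else 0)" for k
  define p :: "nat \<Rightarrow> quat" where "p k = of_real (a k)" for k
  define f where "f q = (\<Sum>k\<le>N. q ^ k * p k)" for q :: quat
  define w :: "nat \<Rightarrow> quat \<Rightarrow> quat" where "w k q = q ^ k * of_real t" for k q
  have bound: "norm (f q) < 1" if q: "norm q \<le> 1" for q :: quat
  proof -
    obtain I z where I: "I \<in> imag_units" and qz: "q = slice_embed I z" by (rule quat_in_slice)
    have z: "norm z \<le> 1" using q by (simp add: qz norm_slice_embed[OF I])
    define P where "P = 1 + 2 * (\<Sum>k<N. (of_real t * z) ^ Suc k)"
    have ReP: "Re P \<ge> \<delta>"
      unfolding P_def by (rule truncated_herglotz_kernel_Re_ge) (use t z N in \<open>auto simp: \<delta>_def \<sigma>_def[symmetric]\<close>)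
    have "norm P \<le> 1 + norm (2 * (\<Sum>k<N. (of_real t * z) ^ Suc k))"
      unfolding P_def using norm_triangle_ineq[of 1] by (metis norm_one)
    also have "norm (2 * (\<Sum>k<N. (of_real t * z) ^ Suc k)) \<le> 2 * (\<Sum>k<N. 1)"
      unfolding norm_mult
    proof (intro mult_mono order_trans[OF norm_sum] sum_mono)
      show "norm ((of_real t * z) ^ Suc k) \<le> 1" for k
        unfolding norm_power norm_mult using t z by (intro power_le_one mult_le_one mult_nonneg_nonneg) auto
    qed (auto intro: sum_nonneg)
    finally have P: "norm P \<le> B" by (simp add: B_def)
    \<comment> \<open>The coefficients are real, so f maps each slice into itself and a complex
      polynomial remains to be estimated.\<close>
    have "f q = slice_embed I (\<Sum>k\<le>N. of_real (a k) * z ^ k)"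
      unfolding f_def qz p_def linear_sum[OF bounded_linear.linear[OF bounded_linear_slice_embed[OF I]]]
      by (simp add: slice_embed_scaleR slice_embed_power[OF I] of_real_def)
    also have "(\<Sum>k\<le>N. of_real (a k) * z ^ k) = 1 - of_real e * P"
    proof -
      have "(\<Sum>k\<le>N. of_real (a k) * z ^ k) = of_real (1 - e) + (\<Sum>k<N. of_real (a (Suc k)) * z ^ Suc k)"
        by (simp add: a_def sum.atMost_shift)
      also have "(\<Sum>k<N. of_real (a (Suc k)) * z ^ Suc k) = (\<Sum>k<N. - 2 * of_real e * (of_real t * z) ^ Suc k)"
        by (intro sum.cong) (auto simp: a_def power_mult_distrib)
      finally show ?thesis by (simp add: P_def algebra_simps sum_distrib_left sum_negf)
    qed
    finally have "norm (f q) = norm (1 - of_real e * P)" by (simp add: norm_slice_embed[OF I])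
    hence "(norm (f q))\<^sup>2 = 1 - 2 * e * Re P + e\<^sup>2 * (norm P)\<^sup>2"
      by (simp add: cmod_power2) (simp add: power2_eq_square algebra_simps)
    also have "\<dots> \<le> 1 - 2 * e * \<delta> + e\<^sup>2 * B\<^sup>2"
      using ReP P e by (intro add_mono diff_mono mult_left_mono power_mono) auto
    also have "\<dots> = 1 - 2 * e * \<delta> + e * (e * B\<^sup>2)" by (simp add: power2_eq_square)
    also have "\<dots> \<le> 1 - 2 * e * \<delta> + e * \<delta>"
      using e by (intro add_left_mono mult_left_mono) auto
    also have "\<dots> < 1\<^sup>2" using e \<delta> by simp
    finally show ?thesis by (rule power2_less_imp_less) simp
  qed
  show thesis
  proof (rule that)
    have "slice_regular f" by (rule slice_polynomial(1)[of "{..N}" _ p]) (auto simp: f_def)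
    thus "f \<in> SB"
      using bound by (auto simp: SB_def f_def[abs_def] intro!: continuous_intros)
    show "has_slice_expansion f p"
      unfolding has_slice_expansion_def f_def by (auto intro!: sums_finite simp: p_def a_def split: if_splits)
    show "w k \<in> SB_n k" for k
      unfolding w_def[abs_def] using t by (intro monomial_in_SB_n)
    show "\<not> bohr_ineq m p w (of_real r)"
    proof
      assume *: "bohr_ineq m p w (of_real r)"
      define x where "x k = norm (w (Suc k) (of_real r) * p (Suc k))" for k
      have x: "x k = (if k < N then 2 * e * t * (t * r) ^ Suc k else 0)" for k
        using t r0 e by (auto simp: x_def w_def p_def a_def norm_mult norm_power power_mult_distrib)
      have "suminf x = (\<Sum>k<N. x k)" by (rule suminf_finite) (auto simp: x)
      also have "\<dots> = e * K" by (simp add: x K_def sum_distrib_left mult_ac)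
      finally have sx: "suminf x = e * K" .
      have w1: "norm (w 1 (of_real r)) < 1"
        using tr t r0 by (simp add: w_def norm_mult mult.commute)
      have p0: "norm (p 0) = 1 - e" using e by (simp add: p_def a_def norm_of_real del: of_real_diff)
      \<comment> \<open>The third summand is nonnegative, so the first two alone already violate the
        inequality.\<close>
      have "0 \<le> (1 / (1 + norm (p 0)) + norm (w 1 (of_real r)) / (1 - norm (w 1 (of_real r)))) * (\<Sum>k. (x k)\<^sup>2)"
        using * w1 unfolding bohr_ineq_def x_def[symmetric]
        by (intro mult_nonneg_nonneg add_nonneg_nonneg suminf_nonneg divide_nonneg_nonneg) auto
      with * have "norm (p 0) powr m + suminf x \<le> 1"
        unfolding bohr_ineq_def x_def[symmetric] by linarith
      thus False using d(2)[of e] e by (simp add: sx p0)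
    qed
  qed
qed

theorem theorem1p5:
  fixes m :: real
  assumes "0 < m" and "m \<le> 1"
  shows "(\<forall>f p w q. f \<in> SB \<and> has_slice_expansion f p \<and> (\<forall>k\<ge>1. w k \<in> SB_n k) \<and>
            norm q \<le> m / (m + 2) \<longrightarrow> bohr_ineq m p w q) \<and>
         (\<forall>R > m / (m + 2). \<exists>f p w q. f \<in> SB \<and> has_slice_expansion f p \<and>
            (\<forall>k\<ge>1. w k \<in> SB_n k) \<and> norm q \<le> R \<and> norm q < 1 \<and> \<not> bohr_ineq m p w q)"
proof (intro conjI allI impI)
  fix f p w and q :: quat
  assume *: "f \<in> SB \<and> has_slice_expansion f p \<and> (\<forall>k\<ge>1. w k \<in> SB_n k) \<and> norm q \<le> m / (m + 2)"
  have "m / (m + 2) < 1" using assms by simp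
  hence q: "norm q < 1" using * by linarith
  show "bohr_ineq m p w q"
  proof (rule bohr_ineq_from_schwarz_bounds)
    show "norm (f q) \<le> 1" if "norm q < 1" for q :: quat
      using * that by (auto simp: SB_def less_imp_le)
    show "norm (w k q) \<le> norm q ^ k" if "k \<ge> 1" for k
      using * q that by (intro SB_n_norm_le) auto
  qed (use assms * in auto)
next
  fix R assume R: "m / (m + 2) < R"
  have "m / (m + 2) < 1" using assms by simp
  \<comment> \<open>The cap at 1 keeps the counterexample inside the ball even for R \<ge>
    1.\<close>
  with R obtain r where r: "m / (m + 2) < r" "r < min R 1"
    using dense[of "m / (m + 2)" "min R 1"] by auto
  obtain f p w where "f \<in> SB" "has_slice_expansion f p" "\<And>k. w k \<in> SB_n k"
      "\<not> bohr_ineq m p w (of_real r)"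
    by (rule bohr_radius_sharp[OF assms(1) r(1)]) (use r in auto)
  moreover have "0 < r" using r assms by (meson divide_pos_pos add_pos_pos zero_less_numeral less_trans)
  ultimately show "\<exists>f p w q. f \<in> SB \<and> has_slice_expansion f p \<and>
            (\<forall>k\<ge>1. w k \<in> SB_n k) \<and> norm q \<le> R \<and> norm q < 1 \<and> \<not> bohr_ineq m p w q"
    using r by (intro exI[of _ f] exI[of _ p] exI[of _ w] exI[of _ "of_real r"]) auto
qed

end
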